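(* Let $\mathfrak k$ be a field, $n\ge2$, $A=\mathfrak k\langle x_1,\dots,x_n\rangle$ the free associative algebra, and let $R$ be either the rational closure $A^{\rm rat}_{\bar A}$ or the algebraic closure $A^{\rm alg}_{\bar A}$ of $A$ in the power series algebra $\Gamma=\mathfrak k\langle\langle x_1,\dots,x_n\rangle\rangle$. Then the Leavitt localization $L(R)$, inverting universally the row $(x_1,\dots,x_n)$, is a simple algebra.
   Context: For $r\in\Gamma$ with zero constant term, its quasi-inverse is $r^+=\sum_{m\ge1}r^m$. $A^{\rm rat}_{\bar A}$ is the smallest subalgebra of $\Gamma$ containing $A$ and closed under quasi-inverses of its elements with zero constant term. $A^{\rm alg}_{\bar A}$ is the algebra of algebraic power series: those of the form $c+u_1$ with $c\in\mathfrak k$ and $u_1$ the first component of the unique solution $(u_1,\dots,u_m)$, with all $u_i\in\Gamma$ of zero constant term, of a system $u_i=\varphi_i(u_1,\dots,u_m,x_1,\dots,x_n)$ ($i=1,\dots,m$), where the $\varphi_i$ are non-commutative polynomials over $\mathfrak k$ without constant term and without terms of degree $1$ that are scalar multiples of a single $u_j$. $L(R)$ is the algebra generated over $R$ by $x_1^*,\dots,x_n^*$ subject to $x_i^*x_j=\delta_{ij}$ and $\sum_{i=1}^nx_ix_i^*=1$. Simple means having no two-sided ideals other than $0$ and itself. *)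

theory Defs
  imports "HOL-Algebra.QuotRing" "HOL-Algebra.Embedded_Algebras" "HOL-Library.Cardinality"
begin

text \<open>
  A power series in non-commuting variables is its coefficient function on words.
  The variables are the elements of the type \<open>'a\<close>, the coefficient field is the type \<open>'k\<close>.
\<close>

type_synonym ('a, 'k) series = "'a list \<Rightarrow> 'k"

definition series_ring :: "('a, 'k::field) series ring" where
  "series_ring = \<lparr>carrier = UNIV,
     mult = (\<lambda>f g w. \<Sum>i\<le>length w. f (take i w) * g (drop i w)),
     one = (\<lambda>w. if w = [] then 1 else 0),
     zero = (\<lambda>w. 0),
     add = (\<lambda>f g w. f w + g w)\<rparr>"

definition series_const :: "'k::field \<Rightarrow> ('a, 'k) series" where
  "series_const c = (\<lambda>w. if w = [] then c else 0)"

definition series_var :: "'a \<Rightarrow> ('a, 'k::field) series" where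
  "series_var a = (\<lambda>w. if w = [a] then 1 else 0)"

definition free_algebra :: "'a set \<Rightarrow> ('a, 'k::field) series ring" where
  "free_algebra X = series_ring
     \<lparr>carrier := {f. finite {w. f w \<noteq> 0} \<and> (\<forall>w. f w \<noteq> 0 \<longrightarrow> set w \<subseteq> X)}\<rparr>"

lemma ring_series_ring: "ring (series_ring :: ('a, 'k::field) series ring)"
proof (rule ringI)
  show "abelian_group (series_ring :: ('a, 'k) series ring)"
  proof (rule abelian_groupI, goal_cases)
    case (6 x)
    show ?case
      by (rule bexI[of _ "\<lambda>w. - x w"]) (auto simp: series_ring_def)
  qed (auto simp: series_ring_def algebra_simps)
  show "monoid (series_ring :: ('a, 'k) series ring)"
  proof (rule monoidI, goal_cases)
    case (3 f g h)
    show ?case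
    proof
      fix w :: "'a list"
      let ?n = "length w"
      let ?t = "\<lambda>j k. f (take j w) * g (take k (drop j w)) * h (drop (j + k) w)"
      have "(f \<otimes>\<^bsub>series_ring\<^esub> g \<otimes>\<^bsub>series_ring\<^esub> h) w = (\<Sum>i\<le>?n. \<Sum>j\<le>i. ?t j (i - j))"
        unfolding series_ring_def monoid.simps
        by (auto simp: sum_distrib_right min_def drop_take intro!: sum.cong)
      also have "\<dots> = (\<Sum>(j, k)\<in>{(j, k). j + k \<le> ?n}. ?t j k)"
        by (rule sum.triangle_reindex_eq[symmetric])
      also have "{(j, k). j + k \<le> ?n} = (SIGMA j:{..?n}. {..?n - j})"
        by auto
      also have "(\<Sum>(j, k)\<in>\<dots>. ?t j k) = (\<Sum>j\<le>?n. \<Sum>k\<le>?n - j. ?t j k)"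
        by (subst sum.Sigma) auto
      also have "\<dots> = (f \<otimes>\<^bsub>series_ring\<^esub> (g \<otimes>\<^bsub>series_ring\<^esub> h)) w"
        unfolding series_ring_def monoid.simps
        by (auto simp: sum_distrib_left mult.assoc add.commute intro!: sum.cong)
      finally show "(f \<otimes>\<^bsub>series_ring\<^esub> g \<otimes>\<^bsub>series_ring\<^esub> h) w
        = (f \<otimes>\<^bsub>series_ring\<^esub> (g \<otimes>\<^bsub>series_ring\<^esub> h)) w" .
    qed
  next
    case (4 f)
    have "(\<Sum>i\<le>length w. (if take i w = [] then 1 else 0) * f (drop i w)) = f w" for w :: "'a list"
      by (subst sum.mono_neutral_right[of _ "{0}"]) auto
    then show ?case by (auto simp: series_ring_def)
  next
    case (5 f)
    have "(\<Sum>i\<le>length w. f (take i w) * (if drop i w = [] then 1 else 0)) = f w" for w :: "'a list"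
      by (subst sum.mono_neutral_right[of _ "{length w}"]) auto
    then show ?case by (auto simp: series_ring_def)
  qed (auto simp: series_ring_def)
qed (auto simp: series_ring_def algebra_simps sum.distrib)

text \<open>
  The sum of all powers \<open>r\<^sup>m\<close> with \<open>m \<ge> 1\<close>. If \<open>r\<close> has zero constant term then
  \<open>r\<^sup>m\<close> has no terms of degree less than \<open>m\<close>, so the coefficient of a word only
  receives contributions from \<open>m \<le> length w\<close>.
\<close>

definition quasi_inverse :: "('a, 'k::field) series \<Rightarrow> ('a, 'k) series" where
  "quasi_inverse r = (\<lambda>w. \<Sum>m=1..length w. (r [^]\<^bsub>series_ring\<^esub> m) w)"

lemma series_pow_order:
  fixes r :: "('a, 'k::field) series"
  assumes "r [] = 0" "length w < m"
  shows "(r [^]\<^bsub>series_ring\<^esub> m) w = 0"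
  using assms(2)
proof (induction m arbitrary: w)
  case (Suc m)
  interpret ring "series_ring :: ('a, 'k) series ring" by (rule ring_series_ring)
  have "(r [^]\<^bsub>series_ring\<^esub> m) (take i w) * r (drop i w) = 0" if "i \<le> length w" for i
    using that Suc.prems assms(1) by (cases "i = length w") (auto intro!: Suc.IH)
  moreover have "(r [^]\<^bsub>series_ring\<^esub> Suc m) w
      = (\<Sum>i\<le>length w. (r [^]\<^bsub>series_ring\<^esub> m) (take i w) * r (drop i w))"
    by (subst nat_pow_Suc) (simp only: series_ring_def monoid.simps)
  ultimately show ?case
    by (metis (mono_tags, lifting) atMost_iff sum.neutral)
qed simp

text \<open>
  The library predicate \<^term>\<open>subalgebra\<close> only demands a linear subspace; closure under
  multiplication and the unit come from \<^term>\<open>subring\<close>.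
\<close>

definition rational_series :: "('a, 'k::field) series set" where
  "rational_series = \<Inter> {V. subring V series_ring \<and> subalgebra (range series_const) V series_ring \<and>
     carrier (free_algebra UNIV) \<subseteq> V \<and> (\<forall>r\<in>V. r [] = 0 \<longrightarrow> quasi_inverse r \<in> V)}"

text \<open>
  A polynomial in \<open>u\<^sub>0, u\<^sub>1, \<dots>\<close> and in the variables of the series is a series over
  the alphabet \<open>nat + 'a\<close>, with \<open>Inl j\<close> standing for \<open>u\<^sub>j\<close> and \<open>Inr x\<close> for the variable \<open>x\<close>.
\<close>

definition word_value :: "(nat \<Rightarrow> ('a, 'k::field) series) \<Rightarrow> (nat + 'a) list \<Rightarrow> ('a, 'k) series" where
  "word_value u v = foldr (\<lambda>s p. case_sum u series_var s \<otimes>\<^bsub>series_ring\<^esub> p) v \<one>\<^bsub>series_ring\<^esub>"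

definition poly_value :: "(nat \<Rightarrow> ('a, 'k::field) series) \<Rightarrow> (nat + 'a, 'k) series \<Rightarrow> ('a, 'k) series" where
  "poly_value u p = (\<lambda>w. \<Sum>v | p v \<noteq> 0. p v * word_value u v w)"

definition proper_system :: "nat \<Rightarrow> (nat \<Rightarrow> (nat + 'a, 'k::field) series) \<Rightarrow> bool" where
  "proper_system m p \<longleftrightarrow>
     (\<forall>i<m. p i \<in> carrier (free_algebra (Inl ` {..<m} \<union> range Inr)) \<and>
            p i [] = 0 \<and> (\<forall>j<m. p i [Inl j] = 0))"

definition solves_system ::
  "nat \<Rightarrow> (nat \<Rightarrow> (nat + 'a, 'k::field) series) \<Rightarrow> (nat \<Rightarrow> ('a, 'k) series) \<Rightarrow> bool" where
  "solves_system m p u \<longleftrightarrow> (\<forall>i<m. u i [] = 0 \<and> u i = poly_value u (p i))"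

lemma word_value_simps:
  "word_value u [] = \<one>\<^bsub>series_ring\<^esub>"
  "word_value u (s # v) w = (\<Sum>i\<le>length w. case_sum u series_var s (take i w) * word_value u v (drop i w))"
  by (simp_all add: word_value_def series_ring_def)

lemma word_value_order:
  assumes "\<And>j. j < m \<Longrightarrow> u j [] = 0" "set v \<subseteq> Inl ` {..<m} \<union> range Inr" "length w < length v"
  shows "word_value u v w = 0"
  using assms(2,3)
proof (induction v arbitrary: w)
  case (Cons s v)
  have "case_sum u series_var s [] = 0"
    using Cons.prems assms(1) by (auto simp: series_var_def)
  then have "case_sum u series_var s (take i w) * word_value u v (drop i w) = 0" if "i \<le> length w" for i
    using that Cons by (cases "i = 0") auto
  then show ?case unfolding word_value_simps by (intro sum.neutral) blast
qed simp

lemma word_value_cong: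
  assumes u: "\<And>j. j < m \<Longrightarrow> u j [] = 0" and u': "\<And>j. j < m \<Longrightarrow> u' j [] = 0"
    and eq: "\<And>j w. j < m \<Longrightarrow> length w < N \<Longrightarrow> u j w = u' j w"
    and v: "set v \<subseteq> Inl ` {..<m} \<union> range Inr" and w: "length w + 1 < N + length v"
  shows "word_value u v w = word_value u' v w"
  using v w
proof (induction v arbitrary: w)
  case Nil
  then show ?case by (simp add: word_value_simps)
next
  case (Cons s v)
  have 0: "case_sum u series_var s [] = 0" "case_sum u' series_var s [] = 0"
    using Cons.prems u u' by (auto simp: series_var_def)
  have s: "case_sum u series_var s z = case_sum u' series_var s z" if "length z < N" for z
    using Cons.prems eq that by auto
  have "case_sum u series_var s (take i w) * word_value u v (drop i w)
      = case_sum u' series_var s (take i w) * word_value u' v (drop i w)" if "i \<le> length w" for i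
  proof -
    consider "i = 0" | "length w - i < length v" | "i \<ge> 1" "length w - i \<ge> length v" by linarith
    then show ?thesis
    proof cases
      case 1
      then show ?thesis using 0 by simp
    next
      case 2
      then have "word_value u v (drop i w) = 0" "word_value u' v (drop i w) = 0"
        using word_value_order[of m u v] word_value_order[of m u' v] u u' Cons.prems(1) by auto
      then show ?thesis by simp
    next
      case 3
      have "length (take i w) < N" "length (drop i w) + 1 < N + length v"
        using 3 that Cons.prems(2) by auto
      then show ?thesis using s Cons.IH Cons.prems(1) by simp
    qed
  qed
  then show ?case by (simp add: word_value_simps)
qed

lemma proper_system_unique:
  assumes p: "proper_system m p" and u: "solves_system m p u" and u': "solves_system m p u'"
    and "i < m"
  shows "u i = u' i"
proof -
  have "\<forall>i<m. u i w = u' i w" for w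
  proof (induction w rule: length_induct)
    case (1 w)
    show ?case
    proof (intro allI impI)
      fix i assume i: "i < m"
      have "p i v * word_value u v w = p i v * word_value u' v w" for v
      proof (cases "p i v = 0")
        case False
        have v: "set v \<subseteq> Inl ` {..<m} \<union> range Inr"
          using p i False by (auto simp: proper_system_def free_algebra_def)
        consider x where "v = [Inr x]" | "length v \<ge> 2"
        proof (cases v rule: remdups_adj.cases)
          case 1
          then show ?thesis using p i False by (auto simp: proper_system_def)
        next
          case (2 s)
          then show ?thesis using p i False v that by (cases s) (auto simp: proper_system_def)
        qed (use that in auto)
        then have "word_value u v w = word_value u' v w"
        proof cases
          case 1
          then show ?thesis by (simp add: word_value_simps)
        next
          case 2
          show ?thesis
            by (rule word_value_cong[of m u u' "length w"])
              (use 1 2 u u' v in \<open>auto simp: solves_system_def\<close>)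
        qed
        then show ?thesis by simp
      qed simp
      then have "poly_value u (p i) w = poly_value u' (p i) w"
        unfolding poly_value_def by (intro sum.cong refl)
      then show "u i w = u' i w"
        using u u' i unfolding solves_system_def by metis
    qed
  qed
  then show ?thesis using \<open>i < m\<close> by auto
qed

text \<open>
  By the previous lemma \<open>u 0\<close> below is the first component of the only solution
  without constant terms.
\<close>

definition algebraic_series :: "('a, 'k::field) series set" where
  "algebraic_series = {series_const c \<oplus>\<^bsub>series_ring\<^esub> u 0 | c u.
     \<exists>m p. 0 < m \<and> proper_system m p \<and> solves_system m p u}"

text \<open>
  The presentation of \<open>L(R)\<close> as a \<open>'k\<close>-algebra: one generator \<open>Inl r\<close> for every element \<open>r\<close>
  of \<open>R\<close> and one generator \<open>Inr x\<close> for every \<open>x\<^sup>*\<close>. The first three families of relations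
  say that \<open>r \<mapsto> Inl r\<close> is a homomorphism of unital algebras.
\<close>

definition leavitt_free :: "('a, 'k::field) series set \<Rightarrow> (('a, 'k) series + 'a, 'k) series ring" where
  "leavitt_free R = free_algebra (Inl ` R \<union> range Inr)"

definition leavitt_relations ::
  "('a::finite, 'k::field) series set \<Rightarrow> (('a, 'k) series + 'a, 'k) series set" where
  "leavitt_relations R = (let F = leavitt_free R; e = (\<lambda>r. series_var (Inl r)); s = (\<lambda>x. series_var (Inr x)) in
     {e (a \<oplus>\<^bsub>series_ring\<^esub> b) \<ominus>\<^bsub>F\<^esub> (e a \<oplus>\<^bsub>F\<^esub> e b) | a b. a \<in> R \<and> b \<in> R} \<union>
     {e (a \<otimes>\<^bsub>series_ring\<^esub> b) \<ominus>\<^bsub>F\<^esub> (e a \<otimes>\<^bsub>F\<^esub> e b) | a b. a \<in> R \<and> b \<in> R} \<union>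
     {e (series_const c) \<ominus>\<^bsub>F\<^esub> series_const c | c. True} \<union>
     {s x \<otimes>\<^bsub>F\<^esub> e (series_var y) \<ominus>\<^bsub>F\<^esub> (if x = y then \<one>\<^bsub>F\<^esub> else \<zero>\<^bsub>F\<^esub>) | x y. True} \<union>
     {(\<Oplus>\<^bsub>F\<^esub>x\<in>UNIV. e (series_var x) \<otimes>\<^bsub>F\<^esub> s x) \<ominus>\<^bsub>F\<^esub> \<one>\<^bsub>F\<^esub>})"

definition leavitt_localization ::
  "('a::finite, 'k::field) series set \<Rightarrow> (('a, 'k) series + 'a, 'k) series set ring" where
  "leavitt_localization R = leavitt_free R Quot (Idl\<^bsub>leavitt_free R\<^esub> (leavitt_relations R))"

text \<open>
  In a unital algebra every two-sided ring ideal is a linear subspace, so ring ideals suffice.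
\<close>

definition simple_ring :: "('a, 'b) ring_scheme \<Rightarrow> bool" where
  "simple_ring S \<longleftrightarrow> ring S \<and> carrier S \<noteq> {\<zero>\<^bsub>S\<^esub>} \<and>
     (\<forall>I. ideal I S \<longrightarrow> I = {\<zero>\<^bsub>S\<^esub>} \<or> I = carrier S)"

end

(*
  Both closures contain the left derivatives of their elements (cancel the first letter x in all
  words that start with x) and the inverses of their elements with non-zero constant term.
  Let p be a non-zero element of an ideal of L(R). The relation sum x x^* = 1 gives p w <> 0 for
  some word w of any prescribed length, and if w is long enough then p w lies in the image of R.
  So the ideal contains the image of some r <> 0 in R. If r has no constant term then x^* r is the
  left derivative of r; repeating this along a word of the support of r leads to an element
  with non-zero constant term, which is invertible.
*)
theory Submission
  imports Defs "HOL-Library.Stream"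
begin

section \<open>Power series\<close>

text \<open>Elements of L(R) are given only as cosets in a free algebra, so they are handled by
  induction on generators instead of normal forms. The critical generator is x^*: if p w is the
  image of r, then x^* p w need not come from R, because x^* acts as a derivative only on series
  without constant term. One more letter y repairs this: r y has no constant term, so x^* r y is its
  derivative. Hence the required length of w grows with the number of stars. The way back from L(R)
  to series rests on the zero series having image zero, so that a non-zero image has a non-zero
  representative.

  Simplicity also demands 1 \<noteq> 0. This is obtained from a concrete module on which all
  relations hold.

  What the argument asks of R is collected in a locale. For the rational closure, the derivatives
  come from minimality. For the algebraic closure they need auxiliary unknowns, and indexed systems
  are awkward to merge, so systems are recast as finite sets of series.\<close>

interpretation series: ring "series_ring :: ('a, 'k::field) series ring"
  by (rule ring_series_ring)

abbreviation series_mult :: "('a, 'k::field) series \<Rightarrow> ('a, 'k) series \<Rightarrow> ('a, 'k) series"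
    (infixl "\<star>" 70) where
  "f \<star> g \<equiv> f \<otimes>\<^bsub>series_ring\<^esub> g"

definition series_deriv :: "'a \<Rightarrow> ('a, 'k::field) series \<Rightarrow> ('a, 'k) series" where
  "series_deriv x f = (\<lambda>w. f (x # w))"

lemma carrier_series_ring [simp]: "carrier series_ring = UNIV"
  by (simp add: series_ring_def)

lemma add_series_ring [simp]: "f \<oplus>\<^bsub>series_ring\<^esub> g = (\<lambda>w. f w + g w)"
  by (simp add: series_ring_def)

lemma zero_series_ring [simp]: "\<zero>\<^bsub>series_ring\<^esub> = (\<lambda>w. 0)"
  by (simp add: series_ring_def)

lemma one_series_ring [simp]: "\<one>\<^bsub>series_ring\<^esub> = series_const 1"
  by (simp add: series_ring_def series_const_def)

lemma uminus_series_ring [simp]: "\<ominus>\<^bsub>series_ring\<^esub> f = (\<lambda>w. - f w)"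
  using series.minus_equality[of "\<lambda>w. - f w" f] by simp

lemma mult_apply: "(f \<star> g) w = (\<Sum>i\<le>length w. f (take i w) * g (drop i w))"
  by (simp add: series_ring_def)

lemma mult_Nil [simp]: "(f \<star> g) [] = f [] * g []"
  by (simp add: mult_apply)

text \<open>A prefix of \<open>x # w\<close> is empty or starts with \<open>x\<close>. This
  recursion replaces the convolution sum in most later computations.\<close>

lemma mult_Cons [simp]: "(f \<star> g) (x # w) = f [] * g (x # w) + (series_deriv x f \<star> g) w"
  by (simp add: mult_apply series_deriv_def sum.atMost_Suc_shift del: sum.atMost_Suc)

lemma mult_add_left: "(\<lambda>w. f w + g w) \<star> h = (\<lambda>w. (f \<star> h) w + (g \<star> h) w)"
  by (simp add: fun_eq_iff mult_apply sum.distrib algebra_simps)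

lemma mult_add_right: "h \<star> (\<lambda>w. f w + g w) = (\<lambda>w. (h \<star> f) w + (h \<star> g) w)"
  by (simp add: fun_eq_iff mult_apply sum.distrib algebra_simps)

lemma mult_scale_left: "(\<lambda>w. c * f w) \<star> g = (\<lambda>w. c * (f \<star> g) w)"
  by (simp add: fun_eq_iff mult_apply sum_distrib_left mult.assoc)

lemma mult_scale_right: "f \<star> (\<lambda>w. c * g w) = (\<lambda>w. c * (f \<star> g) w)"
  by (simp add: fun_eq_iff mult_apply sum_distrib_left mult.left_commute)

lemma mult_zero [simp]: "(\<lambda>w. 0) \<star> f = (\<lambda>w. 0)" "f \<star> (\<lambda>w. 0) = (\<lambda>w. 0)"
  by (simp_all add: fun_eq_iff mult_apply)

lemma series_const_Nil [simp]: "series_const c [] = c"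
  by (simp add: series_const_def)

lemma series_const_0 [simp]: "series_const 0 = (\<lambda>w. 0)"
  by (auto simp: series_const_def)

lemma series_deriv_const [simp]: "series_deriv x (series_const c) = (\<lambda>w. 0)"
  by (simp add: series_deriv_def series_const_def)

lemma series_var_Nil [simp]: "series_var x [] = 0"
  by (simp add: series_var_def)

lemma series_deriv_var [simp]:
  "series_deriv x (series_var y) = series_const (if x = y then 1 else 0)"
  by (auto simp: series_deriv_def series_var_def series_const_def)

lemma const_mult [simp]: "series_const c \<star> f = (\<lambda>w. c * f w)"
proof
  show "(series_const c \<star> f) w = c * f w" for w by (cases w) auto
qed

lemma mult_const [simp]: "f \<star> series_const c = (\<lambda>w. f w * c)"
proof
  show "(f \<star> series_const c) w = f w * c" for w
    by (induction w arbitrary: f) (auto simp: series_const_def, simp add: series_deriv_def)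
qed

lemma var_mult_Cons: "(series_var x \<star> f) (y # w) = (if x = y then f w else 0)"
  by simp

lemma series_deriv_mult:
  "series_deriv x (f \<star> g) = (\<lambda>w. f [] * series_deriv x g w + (series_deriv x f \<star> g) w)"
  by (simp add: fun_eq_iff series_deriv_def[of x "f \<star> g"] series_deriv_def[of x g])

lemma series_deriv_add:
  "series_deriv x (\<lambda>w. f w + g w) = (\<lambda>w. series_deriv x f w + series_deriv x g w)"
  by (simp add: series_deriv_def)

text \<open>Each non-empty word has exactly one first letter. The expansion lets x^* be computed on
  R from its values on the variables.\<close>

lemma series_eq_sum_deriv:
  fixes f :: "('a::finite, 'k::field) series"
  assumes "f [] = 0"
  shows "f = (\<lambda>w. \<Sum>x\<in>UNIV. (series_var x \<star> series_deriv x f) w)"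
proof
  show "f w = (\<Sum>x\<in>UNIV. (series_var x \<star> series_deriv x f) w)" for w
  proof (cases w)
    case (Cons y v)
    have "(series_var x \<star> series_deriv x f) w = (if x = y then f w else 0)" for x
      unfolding Cons var_mult_Cons by (simp add: series_deriv_def)
    then show ?thesis by simp
  qed (simp add: assms)
qed

lemma quasi_inverse_Nil [simp]: "quasi_inverse r [] = 0"
  by (simp add: quasi_inverse_def)

lemma quasi_inverse_eq:
  fixes r :: "('a, 'k::field) series"
  assumes "r [] = 0"
  shows "quasi_inverse r = (\<lambda>w. r w + (r \<star> quasi_inverse r) w)"
proof
  fix w :: "'a list"
  let ?n = "length w"
  \<comment> \<open>The upper limit is made the same for all suffixes of \<open>w\<close>, so that
    the two sums can be interchanged; the added powers vanish on short words.\<close>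
  have q: "quasi_inverse r v = (\<Sum>m=1..?n. (r [^]\<^bsub>series_ring\<^esub> m) v)" if "length v \<le> ?n" for v
    unfolding quasi_inverse_def
    by (rule sum.mono_neutral_left) (use that assms in \<open>auto simp: series_pow_order\<close>)
  have "(r \<star> quasi_inverse r) w
      = (\<Sum>i\<le>?n. \<Sum>m=1..?n. r (take i w) * (r [^]\<^bsub>series_ring\<^esub> m) (drop i w))"
    unfolding mult_apply by (intro sum.cong refl) (simp add: q sum_distrib_left)
  also have "\<dots> = (\<Sum>m=1..?n. (r \<star> r [^]\<^bsub>series_ring\<^esub> m) w)"
    unfolding mult_apply by (rule sum.swap)
  also have "\<dots> = (\<Sum>m=1..?n. (r [^]\<^bsub>series_ring\<^esub> Suc m) w)"
    by (subst series.nat_pow_Suc2) auto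
  finally have *: "(r \<star> quasi_inverse r) w = (\<Sum>m=1..?n. (r [^]\<^bsub>series_ring\<^esub> Suc m) w)" .
  have "r w + (\<Sum>m=1..?n. (r [^]\<^bsub>series_ring\<^esub> Suc m) w)
      = (\<Sum>m=0..?n. (r [^]\<^bsub>series_ring\<^esub> Suc m) w)"
    by (subst sum.atLeast_Suc_atMost[of 0]) (simp_all add: series.nat_pow_Suc2 del: series.nat_pow_Suc)
  also have "\<dots> = (\<Sum>m=1..Suc ?n. (r [^]\<^bsub>series_ring\<^esub> m) w)"
    unfolding One_nat_def by (rule sum.shift_bounds_cl_Suc_ivl[symmetric])
  also have "\<dots> = quasi_inverse r w"
    using series_pow_order[of r w "Suc ?n"] assms
    by (simp add: quasi_inverse_def del: series.nat_pow_Suc)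
  finally show "quasi_inverse r w = r w + (r \<star> quasi_inverse r) w" using * by simp
qed

section \<open>Polynomials\<close>

abbreviation series_monom :: "'k::field \<Rightarrow> 'a list \<Rightarrow> ('a, 'k) series" where
  "series_monom c v \<equiv> (\<lambda>w. if w = v then c else 0)"

lemma carrier_free_algebra:
  "f \<in> carrier (free_algebra X) \<longleftrightarrow> finite {w. f w \<noteq> 0} \<and> (\<forall>w. f w \<noteq> 0 \<longrightarrow> set w \<subseteq> X)"
  by (simp add: free_algebra_def)

lemma free_algebra_series_ring [simp]:
  "monoid.mult (free_algebra X) = monoid.mult series_ring"
  "ring.add (free_algebra X) = ring.add series_ring"
  "one (free_algebra X) = one series_ring"
  "zero (free_algebra X) = zero series_ring"
  by (simp_all add: free_algebra_def)

lemma subring_free_algebra: "subring (carrier (free_algebra X :: ('a, 'k::field) series ring)) series_ring"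
proof (rule series.subringI)
  fix f g :: "('a, 'k) series"
  assume f: "f \<in> carrier (free_algebra X)" and g: "g \<in> carrier (free_algebra X)"
  show "\<ominus>\<^bsub>series_ring\<^esub> f \<in> carrier (free_algebra X)"
    using f by (simp add: carrier_free_algebra)
  have "finite {w. f w + g w \<noteq> 0}"
    by (rule finite_subset[of _ "{w. f w \<noteq> 0} \<union> {w. g w \<noteq> 0}"])
      (use f g in \<open>auto simp: carrier_free_algebra\<close>)
  then show "f \<oplus>\<^bsub>series_ring\<^esub> g \<in> carrier (free_algebra X)"
    using f g by (auto simp: carrier_free_algebra) (metis add.right_neutral subsetD)
  have split: "\<exists>u v. w = u @ v \<and> f u \<noteq> 0 \<and> g v \<noteq> 0" if fg: "(f \<star> g) w \<noteq> 0" for w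
  proof -
    obtain i where "f (take i w) * g (drop i w) \<noteq> 0"
      using fg unfolding mult_apply by (meson sum.not_neutral_contains_not_neutral)
    then show ?thesis by (metis append_take_drop_id mult_zero_left mult_zero_right)
  qed
  then have "{w. (f \<star> g) w \<noteq> 0} \<subseteq> (\<lambda>(u, v). u @ v) ` ({w. f w \<noteq> 0} \<times> {w. g w \<noteq> 0})"
    by fastforce
  then have "finite {w. (f \<star> g) w \<noteq> 0}"
    using f g by (auto simp: carrier_free_algebra intro: finite_subset)
  then show "f \<star> g \<in> carrier (free_algebra X)"
    using f g split by (fastforce simp: carrier_free_algebra)
qed (auto simp: carrier_free_algebra series_const_def)

lemma ring_free_algebra: "ring (free_algebra X)"
  using series.subring_is_ring[OF subring_free_algebra[of X]] by (simp add: free_algebra_def)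

text \<open>Negation is not a field of the ring record but is defined through its carrier, so it has
  to be identified separately for the subring.\<close>

lemma uminus_free_algebra [simp]:
  fixes f :: "('a, 'k::field) series"
  assumes "f \<in> carrier (free_algebra X)"
  shows "\<ominus>\<^bsub>free_algebra X\<^esub> f = (\<lambda>w. - f w)"
proof -
  interpret F: ring "free_algebra X :: ('a, 'k) series ring" by (rule ring_free_algebra)
  have "(\<lambda>w. - f w) \<in> carrier (free_algebra X)"
    using assms by (simp add: carrier_free_algebra)
  then show ?thesis using F.minus_equality[of "\<lambda>w. - f w" f] assms by simp
qed

lemma minus_free_algebra [simp]:
  assumes "g \<in> carrier (free_algebra X)"
  shows "f \<ominus>\<^bsub>free_algebra X\<^esub> g = (\<lambda>w. f w - g w)"
  using assms by (simp add: a_minus_def)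

lemma finsum_free_algebra:
  fixes f :: "'i \<Rightarrow> ('a, 'k::field) series"
  assumes "\<And>i. i \<in> I \<Longrightarrow> f i \<in> carrier (free_algebra X)"
  shows "finsum (free_algebra X) f I = (\<lambda>w. \<Sum>i\<in>I. f i w)"
proof -
  interpret F: ring "free_algebra X :: ('a, 'k) series ring" by (rule ring_free_algebra)
  show ?thesis
    using assms by (induction I rule: infinite_finite_induct) (auto simp: F.finsum_infinite)
qed

lemma const_in_free_algebra [simp]: "series_const c \<in> carrier (free_algebra X)"
  by (auto simp: carrier_free_algebra series_const_def)

lemma zero_in_free_algebra [simp]: "(\<lambda>w. 0) \<in> carrier (free_algebra X)"
  by (auto simp: carrier_free_algebra)

lemma var_in_free_algebra [simp]: "s \<in> X \<Longrightarrow> series_var s \<in> carrier (free_algebra X)"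
  by (auto simp: carrier_free_algebra series_var_def)

lemma add_in_free_algebra:
  "f \<in> carrier (free_algebra X) \<Longrightarrow> g \<in> carrier (free_algebra X)
    \<Longrightarrow> (\<lambda>w. f w + g w) \<in> carrier (free_algebra X)"
  using ring.ring_simprules(1)[OF ring_free_algebra, of f X g] by simp

lemma mult_in_free_algebra:
  "f \<in> carrier (free_algebra X) \<Longrightarrow> g \<in> carrier (free_algebra X)
    \<Longrightarrow> f \<star> g \<in> carrier (free_algebra X)"
  using ring.ring_simprules(5)[OF ring_free_algebra, of f X g] by simp

lemma var_mult_monom: "series_var s \<star> series_monom c v = series_monom c (s # v)"
proof
  show "(series_var s \<star> series_monom c v) w = series_monom c (s # v) w" for w
    by (cases w) auto
qed

lemma monom_in_free_algebra: "set v \<subseteq> X \<Longrightarrow> series_monom c v \<in> carrier (free_algebra X)"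
  by (auto simp: carrier_free_algebra)

text \<open>Polynomials are built by multiplying with one letter on the left because word values and
  word actions are right folds over the word.\<close>

lemma free_algebra_induct [consumes 1, case_names const var add]:
  assumes "p \<in> carrier (free_algebra X)"
    and const: "\<And>c. P (series_const c)"
    and var: "\<And>s p. s \<in> X \<Longrightarrow> p \<in> carrier (free_algebra X) \<Longrightarrow> P p \<Longrightarrow> P (series_var s \<star> p)"
    and add: "\<And>p q. p \<in> carrier (free_algebra X) \<Longrightarrow> q \<in> carrier (free_algebra X)
      \<Longrightarrow> P p \<Longrightarrow> P q \<Longrightarrow> P (\<lambda>w. p w + q w)"
  shows "P p"
proof -
  have monom: "P (series_monom c v)" if "set v \<subseteq> X" for c v
    using that
  proof (induction v)
    case Nil
    show ?case using const[of c] by (simp add: series_const_def)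
  next
    case (Cons s v)
    then show ?case using var[of s "series_monom c v"] monom_in_free_algebra[of v X c]
      unfolding var_mult_monom by simp
  qed
  \<comment> \<open>\<open>A\<close> is a finite set containing the support; at each
    \<open>v\<close> of it, either the coefficient is zero or the monomial there is split
    off.\<close>
  have "P q" if "finite A" "q \<in> carrier (free_algebra X)" "{w. q w \<noteq> 0} \<subseteq> A" for A q
    using that
  proof (induction A arbitrary: q)
    case empty
    then have "q = series_const 0" by auto
    then show ?case using const by metis
  next
    case (insert v A)
    show ?case
    proof (cases "q v = 0")
      case True
      then show ?thesis using insert by (intro insert.IH) auto
    next
      case False
      define q' where "q' = q(v := 0)"
      have q': "q' \<in> carrier (free_algebra X)" "{w. q' w \<noteq> 0} \<subseteq> A"
        using insert.prems by (auto simp: q'_def carrier_free_algebra elim: finite_subset[rotated])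
      have v: "set v \<subseteq> X" using insert.prems False by (auto simp: carrier_free_algebra)
      have "q = (\<lambda>w. series_monom (q v) v w + q' w)" by (auto simp: q'_def)
      then show ?thesis
        using add[OF monom_in_free_algebra[OF v] q'(1) monom[OF v] insert.IH[OF q']] by metis
    qed
  qed
  then show ?thesis using assms(1) by (auto simp: carrier_free_algebra)
qed

text \<open>
  Both substitution of series for the variables and the action of a free algebra on a module
  are of the following form, where \<open>\<phi> v\<close> is the value of the word \<open>v\<close>.
\<close>

definition poly_eval :: "('s list \<Rightarrow> 'i \<Rightarrow> 'k::field) \<Rightarrow> ('s, 'k) series \<Rightarrow> 'i \<Rightarrow> 'k" where
  "poly_eval \<phi> p = (\<lambda>z. \<Sum>v | p v \<noteq> 0. p v * \<phi> v z)"

lemma poly_eval_superset: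
  assumes "finite A" "{v. p v \<noteq> 0} \<subseteq> A"
  shows "poly_eval \<phi> p z = (\<Sum>v\<in>A. p v * \<phi> v z)"
  unfolding poly_eval_def by (rule sum.mono_neutral_left) (use assms in auto)

lemma poly_eval_const [simp]: "poly_eval \<phi> (series_const c) = (\<lambda>z. c * \<phi> [] z)"
  by (rule ext, subst poly_eval_superset[of "{[]}"]) (auto simp: series_const_def)

lemma poly_eval_var [simp]: "poly_eval \<phi> (series_var s) = \<phi> [s]"
  by (rule ext, subst poly_eval_superset[of "{[s]}"]) (auto simp: series_var_def)

lemma poly_eval_add:
  assumes "p \<in> carrier (free_algebra X)" "q \<in> carrier (free_algebra X)"
  shows "poly_eval \<phi> (\<lambda>w. p w + q w) = (\<lambda>z. poly_eval \<phi> p z + poly_eval \<phi> q z)"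
proof
  fix z
  let ?A = "{v. p v \<noteq> 0} \<union> {v. q v \<noteq> 0}"
  have "finite ?A" using assms by (simp add: carrier_free_algebra)
  then show "poly_eval \<phi> (\<lambda>w. p w + q w) z = poly_eval \<phi> p z + poly_eval \<phi> q z"
    by (subst (1 2 3) poly_eval_superset[of ?A]) (auto simp: algebra_simps sum.distrib)
qed

lemma poly_eval_scale: "poly_eval \<phi> (\<lambda>w. c * p w) = (\<lambda>z. c * poly_eval \<phi> p z)"
  by (cases "c = 0") (simp_all add: poly_eval_def sum_distrib_left mult.assoc)

text \<open>Prepending \<open>s\<close> maps the support of \<open>p\<close> bijectively onto that
  of the product, so the letter can be absorbed into the word values.\<close>

lemma poly_eval_var_mult: "poly_eval \<phi> (series_var s \<star> p) = poly_eval (\<lambda>v. \<phi> (s # v)) p"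
proof
  fix z
  have s: "(series_var s \<star> p) w \<noteq> 0 \<longleftrightarrow> (\<exists>v. w = s # v \<and> p v \<noteq> 0)" for w by (cases w) auto
  have "{w. (series_var s \<star> p) w \<noteq> 0} = (#) s ` {v. p v \<noteq> 0}" unfolding s by auto
  then show "poly_eval \<phi> (series_var s \<star> p) z = poly_eval (\<lambda>v. \<phi> (s # v)) p z"
    by (simp add: poly_eval_def sum.reindex)
qed


lemma poly_eval_diff:
  assumes "p \<in> carrier (free_algebra X)" "q \<in> carrier (free_algebra X)"
  shows "poly_eval \<phi> (\<lambda>w. p w - q w) = (\<lambda>z. poly_eval \<phi> p z - poly_eval \<phi> q z)"
proof -
  have "(\<lambda>w. - 1 * q w) \<in> carrier (free_algebra X)"
    using assms(2) by (simp add: carrier_free_algebra)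
  from poly_eval_add[OF assms(1) this, of \<phi>] show ?thesis
    unfolding poly_eval_scale by simp
qed

lemma poly_eval_sum:
  assumes "\<And>i. i \<in> I \<Longrightarrow> p i \<in> carrier (free_algebra X)"
  shows "poly_eval \<phi> (\<lambda>w. \<Sum>i\<in>I. p i w) z = (\<Sum>i\<in>I. poly_eval \<phi> (p i) z)"
  using assms
proof (induction I rule: infinite_finite_induct)
  case (insert i I)
  have "(\<lambda>w. \<Sum>i\<in>I. p i w) \<in> carrier (free_algebra X)"
    using insert.prems insert.hyps
    by (subst finsum_free_algebra[symmetric])
      (auto intro!: abelian_monoid.finsum_closed abelian_group.axioms(1) ring.is_abelian_group ring_free_algebra)
  then show ?case
    using insert poly_eval_add[of "p i" X "\<lambda>w. \<Sum>i\<in>I. p i w" \<phi>] by simp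
qed (simp_all add: poly_eval_def)

lemma mult_sum_right:
  "g \<star> (\<lambda>w. \<Sum>v\<in>A. c v * h v w) = (\<lambda>w. \<Sum>v\<in>A. c v * (g \<star> h v) w)"
proof
  fix w
  have "(g \<star> (\<lambda>w. \<Sum>v\<in>A. c v * h v w)) w
      = (\<Sum>i\<le>length w. \<Sum>v\<in>A. c v * (g (take i w) * h v (drop i w)))"
    unfolding mult_apply by (simp add: sum_distrib_left mult.left_commute)
  also have "\<dots> = (\<Sum>v\<in>A. c v * (g \<star> h v) w)"
    unfolding mult_apply sum_distrib_left by (rule sum.swap)
  finally show "(g \<star> (\<lambda>w. \<Sum>v\<in>A. c v * h v w)) w = (\<Sum>v\<in>A. c v * (g \<star> h v) w)" .
qed

section \<open>Substitution of series into polynomials\<close>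

lemma poly_value_eq_eval: "poly_value u p = poly_eval (word_value u) p"
  by (simp add: poly_value_def poly_eval_def)

lemma word_value_Cons: "word_value u (s # v) = case_sum u series_var s \<star> word_value u v"
  by (simp add: word_value_def)

lemma word_value_Nil: "word_value u [] = series_const 1"
  by (simp add: word_value_simps)

lemma poly_value_const: "poly_value u (series_const c) = series_const c"
  unfolding poly_value_eq_eval poly_eval_const word_value_Nil by (auto simp: series_const_def)

lemma poly_value_var: "poly_value u (series_var s) = case_sum u series_var s"
  by (simp add: poly_value_eq_eval word_value_Cons word_value_Nil)

lemma poly_value_var_mult:
  "poly_value u (series_var s \<star> p) = case_sum u series_var s \<star> poly_value u p"
  unfolding poly_value_eq_eval poly_eval_var_mult word_value_Cons
  by (simp add: poly_eval_def mult_sum_right)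

lemma poly_value_mult:
  assumes "p \<in> carrier (free_algebra X)" "q \<in> carrier (free_algebra X)"
  shows "poly_value u (p \<star> q) = poly_value u p \<star> poly_value u q"
  using assms(1)
proof (induction p rule: free_algebra_induct)
  case (const c)
  show ?case by (simp add: poly_value_const) (simp add: poly_value_eq_eval poly_eval_scale)
next
  case (var s p)
  then show ?case by (simp add: series.m_assoc poly_value_var_mult)
next
  case (add p p')
  then show ?case
    using poly_eval_add[of p X p' "word_value u"] assms(2)
      poly_eval_add[of "p \<star> q" X "p' \<star> q" "word_value u"]
    by (simp add: poly_value_eq_eval mult_add_left mult_in_free_algebra)
qed

section \<open>A module over the Leavitt localization\<close>

text \<open>
  Power series act on the functions of infinite words with a degree that vanish in small degrees:
  removing a prefix of length \<open>i\<close> lowers the degree by \<open>i\<close>, so only finitely many prefixes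
  contribute. This module shows that the Leavitt localization is not zero.
\<close>

definition bounded_below :: "int \<Rightarrow> ('a stream \<times> int \<Rightarrow> 'k::field) \<Rightarrow> bool" where
  "bounded_below N f \<longleftrightarrow> (\<forall>s d. d < N \<longrightarrow> f (s, d) = 0)"

definition stream_module :: "('a stream \<times> int \<Rightarrow> 'k::field) set" where
  "stream_module = {f. \<exists>N. bounded_below N f}"

text \<open>Summing over the support in \<open>i\<close> keeps the definition independent of a
  choice of lower bound; the index set is finite whenever \<open>f\<close> is bounded below.\<close>

definition series_act ::
  "('a, 'k::field) series \<Rightarrow> ('a stream \<times> int \<Rightarrow> 'k) \<Rightarrow> 'a stream \<times> int \<Rightarrow> 'k" where
  "series_act r f = (\<lambda>(s, d). \<Sum>i | f (sdrop i s, d - int i) \<noteq> 0.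
     r (stake i s) * f (sdrop i s, d - int i))"

text \<open>x^* puts \<open>x\<close> in front of the stream and raises the degree by one, undoing
  the removal of a first letter by the variable \<open>x\<close>.\<close>

definition gen_act ::
  "('a, 'k::field) series + 'a \<Rightarrow> ('a stream \<times> int \<Rightarrow> 'k) \<Rightarrow> 'a stream \<times> int \<Rightarrow> 'k" where
  "gen_act g f = (case g of Inl r \<Rightarrow> series_act r f | Inr x \<Rightarrow> (\<lambda>(s, d). f (x ## s, d + 1)))"

definition leavitt_act ::
  "(('a, 'k::field) series + 'a, 'k) series \<Rightarrow> ('a stream \<times> int \<Rightarrow> 'k) \<Rightarrow> 'a stream \<times> int \<Rightarrow> 'k" where
  "leavitt_act p f = poly_eval (\<lambda>v. foldr gen_act v f) p"

lemma stream_moduleE: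
  assumes "f \<in> stream_module"
  obtains N where "bounded_below N f"
  using assms by (auto simp: stream_module_def)

lemma bounded_below_mono: "bounded_below N f \<Longrightarrow> M \<le> N \<Longrightarrow> bounded_below M f"
  by (auto simp: bounded_below_def)

text \<open>Every large enough cutoff \<open>n\<close> is allowed, so several functions with a
  common lower bound can be treated with one index set.\<close>

lemma series_act_apply:
  assumes "bounded_below N f" "d - int n \<le> N"
  shows "series_act r f (s, d) = (\<Sum>i\<le>n. r (stake i s) * f (sdrop i s, d - int i))"
proof -
  have "i \<le> n" if "f (sdrop i s, d - int i) \<noteq> 0" for i
  proof (rule ccontr)
    assume "\<not> i \<le> n"
    then have "d - int i < N" using assms(2) by linarith
    then show False using assms(1) that by (simp add: bounded_below_def)
  qed
  then show ?thesis
    unfolding series_act_def prod.case by (intro sum.mono_neutral_left) auto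
qed

lemma bounded_below_series_act:
  assumes "bounded_below N f"
  shows "bounded_below N (series_act r f)"
  using assms by (auto simp: bounded_below_def series_act_def intro!: sum.neutral)

lemma series_act_add:
  "series_act (\<lambda>w. a w + b w) f = (\<lambda>z. series_act a f z + series_act b f z)"
  by (auto simp: series_act_def fun_eq_iff distrib_right sum.distrib)

lemma series_act_const:
  assumes "f \<in> stream_module"
  shows "series_act (series_const c) f = (\<lambda>z. c * f z)"
proof (rule ext, clarify)
  fix s d
  obtain N where N: "bounded_below N f" using assms by (rule stream_moduleE)
  have "series_act (series_const c) f (s, d)
      = (\<Sum>i\<in>{0}. series_const c (stake i s) * f (sdrop i s, d - int i))"
    by (subst series_act_apply[OF N, of d "nat (d - N)"], simp)
      (rule sum.mono_neutral_right, auto simp: series_const_def)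
  then show "series_act (series_const c) f (s, d) = c * f (s, d)" by simp
qed

lemma series_act_var:
  assumes "f \<in> stream_module"
  shows "series_act (series_var x) f = (\<lambda>(s, d). if shd s = x then f (stl s, d - 1) else 0)"
proof (rule ext, clarify)
  fix s d
  obtain N where N: "bounded_below N f" using assms by (rule stream_moduleE)
  have 1: "i = 1" if "stake i s = [x]" for i
    using that length_stake[of i s] by simp
  \<comment> \<open>The \<open>Suc\<close> keeps the index 1 within the cutoff even when
    \<open>d\<close> is at most \<open>N\<close>.\<close>
  have "series_act (series_var x) f (s, d)
      = (\<Sum>i\<in>{1}. series_var x (stake i s) * f (sdrop i s, d - int i))"
    by (subst series_act_apply[OF N, of d "Suc (nat (d - N))"], simp)
      (rule sum.mono_neutral_right, auto simp: series_var_def dest: 1)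
  then show "series_act (series_var x) f (s, d) = (if shd s = x then f (stl s, d - 1) else 0)"
    by (simp add: series_var_def)
qed

text \<open>Cutting a prefix of a stream in two is reindexed as in the associativity of the series
  product.\<close>

lemma series_act_mult:
  assumes "f \<in> stream_module"
  shows "series_act (a \<star> b) f = series_act a (series_act b f)"
proof (rule ext, clarify)
  fix s d
  obtain N where N: "bounded_below N f" using assms by (rule stream_moduleE)
  define n where "n = nat (d - N)"
  let ?t = "\<lambda>i j. a (stake i s) * b (stake j (sdrop i s)) * f (sdrop (i + j) s, d - int (i + j))"
  have n: "d - int n \<le> N" by (simp add: n_def)
  have "series_act (a \<star> b) f (s, d) = (\<Sum>m\<le>n. \<Sum>i\<le>m. ?t i (m - i))"
    unfolding series_act_apply[OF N n] mult_apply
    by (auto simp: sum_distrib_right take_stake drop_stake min_def intro!: sum.cong)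
  also have "\<dots> = (\<Sum>(i, j)\<in>{(i, j). i + j \<le> n}. ?t i j)"
    by (rule sum.triangle_reindex_eq[symmetric])
  also have "{(i, j). i + j \<le> n} = (SIGMA i:{..n}. {..n - i})"
    by auto
  also have "(\<Sum>(i, j)\<in>\<dots>. ?t i j) = (\<Sum>i\<le>n. \<Sum>j\<le>n - i. ?t i j)"
    by (subst sum.Sigma) auto
  also have "\<dots> = (\<Sum>i\<le>n. a (stake i s) * series_act b f (sdrop i s, d - int i))"
  proof (intro sum.cong refl)
    fix i assume "i \<in> {..n}"
    \<comment> \<open>Removing \<open>i\<close> letters has already lowered the degree by
      \<open>i\<close>, so the inner sum may stop at \<open>n - i\<close>.\<close>
    then have "d - int i - int (n - i) \<le> N" using n by simp
    then show "(\<Sum>j\<le>n - i. ?t i j) = a (stake i s) * series_act b f (sdrop i s, d - int i)"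
      by (subst series_act_apply[OF N]) (auto simp: sum_distrib_left algebra_simps)
  qed
  also have "\<dots> = series_act a (series_act b f) (s, d)"
    by (rule series_act_apply[OF bounded_below_series_act[OF N] n, symmetric])
  finally show "series_act (a \<star> b) f (s, d) = series_act a (series_act b f) (s, d)" .
qed

lemma gen_act_closed:
  assumes "f \<in> stream_module"
  shows "gen_act g f \<in> stream_module"
proof -
  obtain N where N: "bounded_below N f" using assms by (rule stream_moduleE)
  show ?thesis
  proof (cases g)
    case (Inl r)
    then show ?thesis
      using bounded_below_series_act[OF N] by (auto simp: gen_act_def stream_module_def)
  next
    case (Inr x)
    have "bounded_below (N - 1) (gen_act g f)"
      using N by (simp add: Inr gen_act_def bounded_below_def)
    then show ?thesis by (auto simp: stream_module_def)
  qed
qed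

lemma gen_act_zero: "gen_act g (\<lambda>z. 0) = (\<lambda>z. 0)"
  by (cases g) (auto simp: gen_act_def series_act_def)

lemma stream_module_lin:
  assumes "f \<in> stream_module" "h \<in> stream_module"
  shows "(\<lambda>z. c * f z + h z) \<in> stream_module"
    and "gen_act g (\<lambda>z. c * f z + h z) = (\<lambda>z. c * gen_act g f z + gen_act g h z)"
proof -
  obtain N where f: "bounded_below N f" and h: "bounded_below N h"
    using assms by (metis stream_moduleE bounded_below_mono min.cobounded1 min.cobounded2)
  then have fh: "bounded_below N (\<lambda>z. c * f z + h z)"
    by (simp add: bounded_below_def)
  then show "(\<lambda>z. c * f z + h z) \<in> stream_module" by (auto simp: stream_module_def)
  show "gen_act g (\<lambda>z. c * f z + h z) = (\<lambda>z. c * gen_act g f z + gen_act g h z)"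
  proof (cases g)
    case (Inl r)
    show ?thesis
    proof (rule ext, clarify)
      fix s d
      have n: "d - int (nat (d - N)) \<le> N" by simp
      show "gen_act g (\<lambda>z. c * f z + h z) (s, d) = c * gen_act g f (s, d) + gen_act g h (s, d)"
        unfolding Inl gen_act_def sum.case series_act_apply[OF f n] series_act_apply[OF h n]
          series_act_apply[OF fh n]
        by (simp add: sum_distrib_left sum.distrib algebra_simps)
    qed
  qed (auto simp: gen_act_def)
qed

lemma stream_module_sum:
  assumes "\<And>v. v \<in> A \<Longrightarrow> h v \<in> stream_module"
  shows "(\<lambda>z. \<Sum>v\<in>A. c v * h v z) \<in> stream_module"
    and "gen_act g (\<lambda>z. \<Sum>v\<in>A. c v * h v z) = (\<lambda>z. \<Sum>v\<in>A. c v * gen_act g (h v) z)"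
proof -
  \<comment> \<open>Both claims go into one induction: linearity at the new summand requires the
    remaining sum to be in the module.\<close>
  have "(\<lambda>z. \<Sum>v\<in>A. c v * h v z) \<in> stream_module \<and>
    gen_act g (\<lambda>z. \<Sum>v\<in>A. c v * h v z) = (\<lambda>z. \<Sum>v\<in>A. c v * gen_act g (h v) z)"
    using assms
  proof (induction A rule: infinite_finite_induct)
    case (insert v A)
    then show ?case using stream_module_lin[of "h v" "\<lambda>z. \<Sum>v\<in>A. c v * h v z"] by simp
  qed (auto simp: gen_act_zero stream_module_def bounded_below_def)
  then show "(\<lambda>z. \<Sum>v\<in>A. c v * h v z) \<in> stream_module"
    and "gen_act g (\<lambda>z. \<Sum>v\<in>A. c v * h v z) = (\<lambda>z. \<Sum>v\<in>A. c v * gen_act g (h v) z)" by auto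
qed

lemma word_act_closed: "f \<in> stream_module \<Longrightarrow> foldr gen_act v f \<in> stream_module"
  by (induction v) (auto simp: gen_act_closed)

lemma leavitt_act_closed: "f \<in> stream_module \<Longrightarrow> leavitt_act p f \<in> stream_module"
  unfolding leavitt_act_def poly_eval_def by (intro stream_module_sum word_act_closed)

lemma leavitt_act_const: "leavitt_act (series_const c) f = (\<lambda>z. c * f z)"
  by (simp add: leavitt_act_def)

lemma leavitt_act_var: "leavitt_act (series_var g) f = gen_act g f"
  by (simp add: leavitt_act_def)

lemma leavitt_act_zero: "leavitt_act p (\<lambda>z. 0) = (\<lambda>z. 0)"
proof -
  have "foldr gen_act v (\<lambda>z. 0) = (\<lambda>z. 0)" for v :: "(('a, 'b) series + 'a) list"
    by (induction v) (simp_all add: gen_act_zero)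
  then show ?thesis by (simp add: leavitt_act_def poly_eval_def)
qed

lemma leavitt_act_var_mult:
  "f \<in> stream_module \<Longrightarrow> leavitt_act (series_var g \<star> p) f = gen_act g (leavitt_act p f)"
  unfolding leavitt_act_def poly_eval_var_mult
  by (simp add: poly_eval_def stream_module_sum word_act_closed)

lemma leavitt_act_mult:
  assumes "p \<in> carrier (free_algebra X)" "q \<in> carrier (free_algebra X)" "f \<in> stream_module"
  shows "leavitt_act (p \<star> q) f = leavitt_act p (leavitt_act q f)"
  using assms(1)
proof (induction p rule: free_algebra_induct)
  case (const c)
  show ?case by (simp add: leavitt_act_const) (simp add: leavitt_act_def poly_eval_scale)
next
  case (var s p)
  then show ?case
    using assms(3) by (simp add: series.m_assoc leavitt_act_var_mult leavitt_act_closed)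
next
  case (add p p')
  then show ?case
    using assms(2) poly_eval_add[of p X p' "\<lambda>v. foldr gen_act v (leavitt_act q f)"]
      poly_eval_add[of "p \<star> q" X "p' \<star> q" "\<lambda>v. foldr gen_act v f"]
    by (simp add: leavitt_act_def mult_add_left mult_in_free_algebra)
qed

definition annihilator ::
  "('a, 'k::field) series set \<Rightarrow> (('a, 'k) series + 'a, 'k) series set" where
  "annihilator R = {p \<in> carrier (leavitt_free R). \<forall>f\<in>stream_module. leavitt_act p f = (\<lambda>z. 0)}"

text \<open>As for any module, absorption on the left holds because zero is sent to zero, and
  absorption on the right because the action preserves \<open>stream_module\<close>.\<close>

lemma ideal_annihilator: "ideal (annihilator R) (leavitt_free R)"
proof -
  let ?F = "leavitt_free R"
  interpret F: ring ?F unfolding leavitt_free_def by (rule ring_free_algebra)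
  show ?thesis
  proof (rule idealI)
    show "subgroup (annihilator R) (add_monoid ?F)"
    proof (rule F.add.subgroupI)
      show "annihilator R \<noteq> {}"
        by (auto simp: annihilator_def leavitt_free_def leavitt_act_def poly_eval_def intro!: exI[of _ "\<lambda>w. 0"])
    next
      fix p assume p: "p \<in> annihilator R"
      have "leavitt_act (\<lambda>w. - p w) f = (\<lambda>z. - leavitt_act p f z)" for f
        using poly_eval_scale[of _ "- 1" p] by (simp add: leavitt_act_def)
      then show "\<ominus>\<^bsub>?F\<^esub> p \<in> annihilator R"
        using p F.a_inv_closed[of p] by (auto simp: annihilator_def leavitt_free_def)
    next
      fix p q assume p: "p \<in> annihilator R" "q \<in> annihilator R"
      then show "p \<oplus>\<^bsub>?F\<^esub> q \<in> annihilator R"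
        using F.a_closed[of p q] by (auto simp: annihilator_def leavitt_free_def leavitt_act_def poly_eval_add)
    qed (auto simp: annihilator_def)
  next
    fix a p assume a: "a \<in> annihilator R" and p: "p \<in> carrier ?F"
    show "p \<otimes>\<^bsub>?F\<^esub> a \<in> annihilator R"
      using a p F.m_closed[of p a]
      by (auto simp: annihilator_def leavitt_free_def leavitt_act_mult leavitt_act_zero)
    show "a \<otimes>\<^bsub>?F\<^esub> p \<in> annihilator R"
      using a p F.m_closed[of a p]
      by (auto simp: annihilator_def leavitt_free_def leavitt_act_mult leavitt_act_closed)
  qed (rule F.ring_axioms)
qed


section \<open>Simplicity of the Leavitt localization\<close>

text \<open>Although words are built from the left, the treatment of x^* in L(R) has to split off a
  last letter.\<close>

lemma monom_snoc: "series_monom c v \<star> series_var y = series_monom c (v @ [y])"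
proof (induction v)
  case Nil
  have *: "series_monom c [] = series_const c" by (simp add: series_const_def)
  show ?case unfolding * const_mult by (auto simp: series_var_def)
next
  case (Cons s v)
  have "series_monom c (s # v) \<star> series_var y = series_var s \<star> (series_monom c v \<star> series_var y)"
    by (simp only: var_mult_monom[symmetric] series.m_assoc carrier_series_ring UNIV_I)
  then show ?case unfolding Cons var_mult_monom by simp
qed

text \<open>The common ground of the two closures: derivatives express the action of x^* on R, and
  quasi-inverses provide inverses of series with non-zero constant term.\<close>

locale leavitt_base =
  fixes R :: "('a::finite, 'k::field) series set"
  assumes subring: "subring R series_ring"
    and const: "series_const c \<in> R"
    and var: "series_var x \<in> R"
    and deriv: "r \<in> R \<Longrightarrow> series_deriv x r \<in> R"
    and quasi_inverse: "r \<in> R \<Longrightarrow> r [] = 0 \<Longrightarrow> quasi_inverse r \<in> R"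
begin

abbreviation "F \<equiv> leavitt_free R"
abbreviation "J \<equiv> Idl\<^bsub>F\<^esub> (leavitt_relations R)"
abbreviation "L \<equiv> leavitt_localization R"
abbreviation "elt r \<equiv> J +>\<^bsub>F\<^esub> series_var (Inl r)"
abbreviation "star x \<equiv> J +>\<^bsub>F\<^esub> series_var (Inr x)"

section \<open>Closure properties of \<open>R\<close>\<close>

lemma add: "a \<in> R \<Longrightarrow> b \<in> R \<Longrightarrow> (\<lambda>w. a w + b w) \<in> R"
  using subringE(7)[OF subring, of a b] by simp

lemma mult: "a \<in> R \<Longrightarrow> b \<in> R \<Longrightarrow> a \<star> b \<in> R"
  using subringE(6)[OF subring, of a b] by simp

lemma scale: "a \<in> R \<Longrightarrow> (\<lambda>w. c * a w) \<in> R"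
  using mult[OF const[of c], of a] by simp

lemma zero: "(\<lambda>w. 0) \<in> R"
  using const[of 0] by simp

lemma sum: "(\<And>i. i \<in> I \<Longrightarrow> f i \<in> R) \<Longrightarrow> (\<lambda>w. \<Sum>i\<in>I. f i w) \<in> R"
  by (induction I rule: infinite_finite_induct) (auto simp: zero add)

lemma monom: "series_monom c v \<in> R"
proof (induction v)
  case Nil
  then show ?case using const[of c] by (simp add: series_const_def)
next
  case (Cons s v)
  then show ?case using mult[OF var] by (simp add: var_mult_monom[symmetric])
qed

section \<open>The quotient map and the defining relations in \<open>L\<close>\<close>

lemma ring_F: "ring F"
  unfolding leavitt_free_def by (rule ring_free_algebra)

sublocale F: ring F by (rule ring_F)

lemma F_ops:
  "p \<oplus>\<^bsub>F\<^esub> q = (\<lambda>w. p w + q w)" "p \<otimes>\<^bsub>F\<^esub> q = p \<star> q" "\<one>\<^bsub>F\<^esub> = series_const 1" "\<zero>\<^bsub>F\<^esub> = (\<lambda>w. 0)"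
  by (simp_all add: leavitt_free_def)

lemma F_minus: "q \<in> carrier F \<Longrightarrow> p \<ominus>\<^bsub>F\<^esub> q = (\<lambda>w. p w - q w)"
  by (simp add: leavitt_free_def)

lemma elt_in_F [simp]: "r \<in> R \<Longrightarrow> series_var (Inl r) \<in> carrier F"
  by (simp add: leavitt_free_def)

lemma star_in_F [simp]: "series_var (Inr x) \<in> carrier F"
  by (simp add: leavitt_free_def)

lemma const_in_F [simp]: "series_const c \<in> carrier F"
  by (simp add: leavitt_free_def)

lemma relations_in_F: "leavitt_relations R \<subseteq> carrier F"
  using add mult const var
  by (auto simp: leavitt_relations_def Let_def intro!: F.minus_closed F.finsum_closed)

lemma relationI:
  "a \<in> R \<Longrightarrow> b \<in> R \<Longrightarrow> series_var (Inl (a \<oplus>\<^bsub>series_ring\<^esub> b))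
    \<ominus>\<^bsub>F\<^esub> (series_var (Inl a) \<oplus>\<^bsub>F\<^esub> series_var (Inl b)) \<in> leavitt_relations R"
  "a \<in> R \<Longrightarrow> b \<in> R \<Longrightarrow> series_var (Inl (a \<star> b))
    \<ominus>\<^bsub>F\<^esub> (series_var (Inl a) \<otimes>\<^bsub>F\<^esub> series_var (Inl b)) \<in> leavitt_relations R"
  "series_var (Inl (series_const c)) \<ominus>\<^bsub>F\<^esub> series_const c \<in> leavitt_relations R"
  "series_var (Inr x) \<otimes>\<^bsub>F\<^esub> series_var (Inl (series_var y))
    \<ominus>\<^bsub>F\<^esub> (if x = y then \<one>\<^bsub>F\<^esub> else \<zero>\<^bsub>F\<^esub>) \<in> leavitt_relations R"
  "(\<Oplus>\<^bsub>F\<^esub>x\<in>UNIV. series_var (Inl (series_var x)) \<otimes>\<^bsub>F\<^esub> series_var (Inr x)) \<ominus>\<^bsub>F\<^esub> \<one>\<^bsub>F\<^esub>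
    \<in> leavitt_relations R"
  unfolding leavitt_relations_def Let_def by blast+

lemma ideal_J: "ideal J F"
  by (rule F.genideal_ideal[OF relations_in_F])

lemma L_eq: "L = F Quot J"
  by (simp add: leavitt_localization_def)

sublocale h: ring_hom_ring F L "(+>\<^bsub>F\<^esub>) J"
  unfolding L_eq by (rule ideal.rcos_ring_hom_ring[OF ideal_J])

lemma relation:
  assumes "p \<ominus>\<^bsub>F\<^esub> q \<in> leavitt_relations R" "p \<in> carrier F" "q \<in> carrier F"
  shows "J +>\<^bsub>F\<^esub> p = J +>\<^bsub>F\<^esub> q"
  using F.quotient_eq_iff_same_a_r_cos[OF ideal_J assms(2,3)] assms(1)
    F.genideal_self[OF relations_in_F] by blast

lemma elt_closed [simp]: "r \<in> R \<Longrightarrow> elt r \<in> carrier L"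
  by simp

lemma elt_add:
  assumes "a \<in> R" "b \<in> R"
  shows "elt (\<lambda>w. a w + b w) = elt a \<oplus>\<^bsub>L\<^esub> elt b"
proof -
  have "elt (a \<oplus>\<^bsub>series_ring\<^esub> b) = J +>\<^bsub>F\<^esub> (series_var (Inl a) \<oplus>\<^bsub>F\<^esub> series_var (Inl b))"
    by (rule relation) (use assms add relationI(1) in auto)
  then show ?thesis using assms by simp
qed

lemma elt_mult:
  assumes "a \<in> R" "b \<in> R"
  shows "elt (a \<star> b) = elt a \<otimes>\<^bsub>L\<^esub> elt b"
proof -
  have "elt (a \<star> b) = J +>\<^bsub>F\<^esub> (series_var (Inl a) \<otimes>\<^bsub>F\<^esub> series_var (Inl b))"
    by (rule relation) (use assms mult relationI(2) in auto)
  then show ?thesis using assms by simp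
qed

text \<open>A scalar occurs twice in the presentation, as an element of \<open>R\<close> with its
  own generator and as a scalar of the free algebra; here the two are identified.\<close>

lemma elt_const: "elt (series_const c) = J +>\<^bsub>F\<^esub> series_const c"
  by (rule relation) (use const relationI(3) in auto)

lemma elt_one: "elt (series_const 1) = \<one>\<^bsub>L\<^esub>"
  using h.hom_one by (simp add: elt_const F_ops)

lemma elt_zero: "elt (\<lambda>w. 0) = \<zero>\<^bsub>L\<^esub>"
  using h.hom_zero elt_const[of 0] by (simp add: F_ops)

lemma star_mult_var: "star x \<otimes>\<^bsub>L\<^esub> elt (series_var y) = (if x = y then \<one>\<^bsub>L\<^esub> else \<zero>\<^bsub>L\<^esub>)"
proof -
  have "J +>\<^bsub>F\<^esub> (series_var (Inr x) \<otimes>\<^bsub>F\<^esub> series_var (Inl (series_var y)))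
      = J +>\<^bsub>F\<^esub> (if x = y then \<one>\<^bsub>F\<^esub> else \<zero>\<^bsub>F\<^esub>)"
    by (rule relation[OF relationI(4)]) (use var in auto)
  then show ?thesis using var[of y] by (auto split: if_splits)
qed

lemma sum_var_star: "(\<Oplus>\<^bsub>L\<^esub>x\<in>UNIV. elt (series_var x) \<otimes>\<^bsub>L\<^esub> star x) = \<one>\<^bsub>L\<^esub>"
proof -
  let ?t = "\<lambda>x. series_var (Inl (series_var x)) \<otimes>\<^bsub>F\<^esub> series_var (Inr x)"
  have t: "?t \<in> UNIV \<rightarrow> carrier F" using var by simp
  have "J +>\<^bsub>F\<^esub> (\<Oplus>\<^bsub>F\<^esub>x\<in>UNIV. ?t x) = J +>\<^bsub>F\<^esub> \<one>\<^bsub>F\<^esub>"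
    by (rule relation) (use t relationI(5) in \<open>auto intro!: F.finsum_closed\<close>)
  then have "(\<Oplus>\<^bsub>L\<^esub>x\<in>UNIV. J +>\<^bsub>F\<^esub> ?t x) = \<one>\<^bsub>L\<^esub>"
    using h.hom_finsum[OF t] by (simp add: o_def)
  then show ?thesis using var by simp
qed

text \<open>This is the induction on polynomials carried through the quotient map. Scalars are
  covered by the case \<open>elt\<close>, and the letters split into the two kinds of
  generators.\<close>

lemma L_induct [consumes 1, case_names elt mult_elt mult_star add]:
  assumes "p \<in> carrier L"
    and elt: "\<And>r. r \<in> R \<Longrightarrow> P (elt r)"
    and mult_elt: "\<And>r p. r \<in> R \<Longrightarrow> p \<in> carrier L \<Longrightarrow> P p \<Longrightarrow> P (elt r \<otimes>\<^bsub>L\<^esub> p)"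
    and mult_star: "\<And>x p. p \<in> carrier L \<Longrightarrow> P p \<Longrightarrow> P (star x \<otimes>\<^bsub>L\<^esub> p)"
    and add: "\<And>p q. p \<in> carrier L \<Longrightarrow> q \<in> carrier L \<Longrightarrow> P p \<Longrightarrow> P q \<Longrightarrow> P (p \<oplus>\<^bsub>L\<^esub> q)"
  shows "P p"
proof -
  have "P (J +>\<^bsub>F\<^esub> q)" if "q \<in> carrier (free_algebra (Inl ` R \<union> range Inr))" for q
    using that
  proof (induction q rule: free_algebra_induct)
    case (const c)
    show ?case using elt[OF leavitt_base.const[OF leavitt_base_axioms, of c]] by (simp add: elt_const)
  next
    case (var s q)
    have q: "q \<in> carrier F" using var by (simp add: leavitt_free_def)
    consider r where "r \<in> R" "s = Inl r" | x where "s = Inr x" using var by auto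
    then show ?case
    proof cases
      case 1
      then show ?thesis
        using mult_elt[of r "J +>\<^bsub>F\<^esub> q"] var(3) q h.hom_mult[of "series_var s" q] by (simp add: F_ops)
    next
      case 2
      then show ?thesis
        using mult_star[of "J +>\<^bsub>F\<^esub> q" x] var(3) q h.hom_mult[of "series_var s" q] by (simp add: F_ops)
    qed
  next
    case (add q q')
    then have "q \<in> carrier F" "q' \<in> carrier F" by (simp_all add: leavitt_free_def)
    then show ?case
      using assms(5)[of "J +>\<^bsub>F\<^esub> q" "J +>\<^bsub>F\<^esub> q'"] add h.hom_add[of q q'] by (simp add: F_ops)
  qed
  moreover have "p \<in> a_rcosets\<^bsub>F\<^esub> J" using assms(1) unfolding L_eq FactRing_def by simp
  then obtain q where "q \<in> carrier F" "p = J +>\<^bsub>F\<^esub> q" unfolding A_RCOSETS_def' by blast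
  ultimately show ?thesis by (simp add: leavitt_free_def)
qed

section \<open>Moving elements of \<open>L\<close> into the image of \<open>R\<close>\<close>

lemma elt_sum:
  assumes "\<And>i. i \<in> I \<Longrightarrow> f i \<in> R"
  shows "elt (\<lambda>w. \<Sum>i\<in>I. f i w) = (\<Oplus>\<^bsub>L\<^esub>i\<in>I. elt (f i))"
  using assms
  by (induction I rule: infinite_finite_induct)
    (auto simp: elt_zero elt_add sum h.S.finsum_infinite)

text \<open>Expand \<open>r\<close> by first letters: x^* cancels the letter \<open>x\<close> and
  kills every other one. A constant term is what this expansion would miss.\<close>

lemma star_mult_elt:
  assumes "r \<in> R" "r [] = 0"
  shows "star x \<otimes>\<^bsub>L\<^esub> elt r = elt (series_deriv x r)"
proof -
  have d: "series_deriv y r \<in> R" for y using assms deriv by blast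
  have "elt r = (\<Oplus>\<^bsub>L\<^esub>y\<in>UNIV. elt (series_var y \<star> series_deriv y r))"
    using elt_sum[of UNIV "\<lambda>y. series_var y \<star> series_deriv y r"] d mult[OF var]
      series_eq_sum_deriv[of r] assms(2) by simp
  then have "star x \<otimes>\<^bsub>L\<^esub> elt r
      = (\<Oplus>\<^bsub>L\<^esub>y\<in>UNIV. star x \<otimes>\<^bsub>L\<^esub> (elt (series_var y) \<otimes>\<^bsub>L\<^esub> elt (series_deriv y r)))"
    using d var by (simp add: elt_mult h.S.finsum_rdistr)
  also have "\<dots> = (\<Oplus>\<^bsub>L\<^esub>y\<in>UNIV. if x = y then elt (series_deriv y r) else \<zero>\<^bsub>L\<^esub>)"
    using d var
    by (intro h.S.finsum_cong') (auto simp: h.S.m_assoc[symmetric] star_mult_var)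
  also have "\<dots> = elt (series_deriv x r)"
    using d by (intro h.S.finsum_singleton) auto
  finally show ?thesis .
qed

text \<open>Any element is of the form \<open>\<Sum> r\<^sub>w w\<^sup>*\<close> over the words \<open>w\<close> of some fixed length.\<close>

lemma eventually_elt:
  assumes "p \<in> carrier L"
  shows "\<exists>N. \<forall>w. N \<le> length w \<longrightarrow> (\<exists>r\<in>R. p \<otimes>\<^bsub>L\<^esub> elt (series_monom 1 w) = elt r)"
  using assms
proof (induction p rule: L_induct)
  case (elt r)
  then show ?case using mult[OF elt monom] elt_mult[OF elt monom] by metis
next
  case (mult_elt r p)
  then show ?case
    using mult[OF mult_elt(1)] elt_mult[OF mult_elt(1)] monom by (metis h.S.m_assoc elt_closed)
next
  case (mult_star x p)
  then obtain N where
    N: "\<And>w. N \<le> length w \<Longrightarrow> \<exists>r\<in>R. p \<otimes>\<^bsub>L\<^esub> elt (series_monom 1 w) = elt r" by blast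
  have "\<exists>r\<in>R. star x \<otimes>\<^bsub>L\<^esub> p \<otimes>\<^bsub>L\<^esub> elt (series_monom 1 w) = elt r" if w: "Suc N \<le> length w" for w
  proof -
    \<comment> \<open>The extra last letter makes the constant term of
      \<open>r \<star> series_var y\<close> vanish, so that \<open>star_mult_elt\<close>
      applies.\<close>
    obtain v y where vy: "w = v @ [y]" using w by (cases w rule: rev_cases) auto
    obtain r where r: "r \<in> R" "p \<otimes>\<^bsub>L\<^esub> elt (series_monom 1 v) = elt r"
      using N[of v] w vy by auto
    have "p \<otimes>\<^bsub>L\<^esub> elt (series_monom 1 w) = elt (r \<star> series_var y)"
      using mult_star(1) r monom var
      by (simp add: vy monom_snoc[symmetric] elt_mult h.S.m_assoc[symmetric])
    then have "star x \<otimes>\<^bsub>L\<^esub> p \<otimes>\<^bsub>L\<^esub> elt (series_monom 1 w) = elt (series_deriv x (r \<star> series_var y))"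
      using mult_star(1) monom star_mult_elt[OF mult[OF r(1) var]] by (simp add: h.S.m_assoc)
    then show ?thesis using deriv mult[OF r(1) var] by blast
  qed
  then show ?case by blast
next
  case (add p q)
  then obtain M N where
    M: "\<And>w. M \<le> length w \<Longrightarrow> \<exists>r\<in>R. p \<otimes>\<^bsub>L\<^esub> elt (series_monom 1 w) = elt r" and
    N: "\<And>w. N \<le> length w \<Longrightarrow> \<exists>r\<in>R. q \<otimes>\<^bsub>L\<^esub> elt (series_monom 1 w) = elt r" by blast
  have "\<exists>r\<in>R. (p \<oplus>\<^bsub>L\<^esub> q) \<otimes>\<^bsub>L\<^esub> elt (series_monom 1 w) = elt r" if w: "M + N \<le> length w" for w
  proof -
    obtain r r' where "r \<in> R" "p \<otimes>\<^bsub>L\<^esub> elt (series_monom 1 w) = elt r"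
      "r' \<in> R" "q \<otimes>\<^bsub>L\<^esub> elt (series_monom 1 w) = elt r'"
      using M[of w] N[of w] w by auto
    then have "(p \<oplus>\<^bsub>L\<^esub> q) \<otimes>\<^bsub>L\<^esub> elt (series_monom 1 w) = elt (\<lambda>w. r w + r' w)"
      using add(1,2) monom by (simp add: h.S.l_distr elt_add)
    then show ?thesis using \<open>r \<in> R\<close> \<open>r' \<in> R\<close> leavitt_base.add[OF leavitt_base_axioms] by blast
  qed
  then show ?case by blast
qed

lemma monoms_faithful:
  assumes "p \<in> carrier L" "\<And>w. length w = N \<Longrightarrow> p \<otimes>\<^bsub>L\<^esub> elt (series_monom 1 w) = \<zero>\<^bsub>L\<^esub>"
  shows "p = \<zero>\<^bsub>L\<^esub>"
  using assms
proof (induction N arbitrary: p)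
  case 0
  have *: "series_monom 1 [] = series_const 1" by (simp add: series_const_def)
  show ?case using 0(1) 0(2)[of "[]"] unfolding * elt_one by simp
next
  case (Suc N)
  \<comment> \<open>The first letter of a word of length \<open>Suc N\<close> is moved over to
    \<open>p\<close>; then \<open>p\<close> is recovered as the sum of the p x x^*.\<close>
  have x: "p \<otimes>\<^bsub>L\<^esub> elt (series_var x) = \<zero>\<^bsub>L\<^esub>" for x
  proof (rule Suc.IH)
    fix w :: "'a list" assume "length w = N"
    then show "p \<otimes>\<^bsub>L\<^esub> elt (series_var x) \<otimes>\<^bsub>L\<^esub> elt (series_monom 1 w) = \<zero>\<^bsub>L\<^esub>"
      using Suc.prems(1) Suc.prems(2)[of "x # w"] var monom
      by (simp add: var_mult_monom[symmetric] elt_mult h.S.m_assoc)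
  qed (use Suc.prems var in simp)
  have "p = p \<otimes>\<^bsub>L\<^esub> (\<Oplus>\<^bsub>L\<^esub>x\<in>UNIV. elt (series_var x) \<otimes>\<^bsub>L\<^esub> star x)"
    using Suc.prems(1) by (simp add: sum_var_star)
  also have "\<dots> = (\<Oplus>\<^bsub>L\<^esub>x\<in>UNIV. p \<otimes>\<^bsub>L\<^esub> (elt (series_var x) \<otimes>\<^bsub>L\<^esub> star x))"
    using Suc.prems(1) var by (intro h.S.finsum_rdistr) auto
  also have "\<dots> = (\<Oplus>\<^bsub>L\<^esub>x\<in>(UNIV :: 'a set). \<zero>\<^bsub>L\<^esub>)"
    using Suc.prems(1) var x by (intro h.S.finsum_cong') (auto simp: h.S.m_assoc[symmetric])
  finally show ?case by simp
qed

text \<open>Write r = c (1 - t) with c the constant term of \<open>r\<close>. The geometric series 1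
  + t^+ inverts 1 - t.\<close>

lemma right_inverse:
  assumes "r \<in> R" "r [] \<noteq> 0"
  shows "\<exists>s\<in>R. r \<star> s = series_const 1"
proof -
  let ?c = "inverse (r [])"
  define t where "t = (\<lambda>w. series_const 1 w + - ?c * r w)"
  have t: "t \<in> R" "t [] = 0"
    unfolding t_def by (rule add[OF const scale[OF assms(1)]]) (use assms(2) in simp)
  let ?q = "quasi_inverse t"
  define s where "s = (\<lambda>w. ?c * (series_const 1 w + ?q w))"
  have s: "s \<in> R"
    unfolding s_def by (intro scale add const quasi_inverse t)
  have r: "r = (\<lambda>w. r [] * (series_const 1 w + - 1 * t w))"
    using assms(2) by (auto simp: t_def fun_eq_iff field_simps)
  have "r \<star> s = (\<lambda>w. ?c * (r \<star> (\<lambda>w. series_const 1 w + ?q w)) w)"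
    unfolding s_def by (rule mult_scale_right)
  also have "r \<star> (\<lambda>w. series_const 1 w + ?q w)
      = (\<lambda>w. r [] * ((\<lambda>w. series_const 1 w + - 1 * t w) \<star> (\<lambda>w. series_const 1 w + ?q w)) w)"
    by (subst r) (rule mult_scale_left)
  also have "(\<lambda>w. series_const 1 w + - 1 * t w) \<star> (\<lambda>w. series_const 1 w + ?q w) = series_const 1"
  proof -
    have *: "(\<lambda>w. series_const 1 w + - 1 * t w) \<star> g = (\<lambda>w. g w - (t \<star> g) w)" for g
      unfolding mult_add_left mult_scale_left const_mult by simp
    show ?thesis
      using fun_cong[OF quasi_inverse_eq[of t, OF t(2)]]
      unfolding * mult_add_right mult_const by (simp add: fun_eq_iff)
  qed
  finally have "r \<star> s = series_const 1"
    using assms(2) by (simp add: fun_eq_iff flip: mult.assoc)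
  then show ?thesis using s by blast
qed

lemma ideal_contains_one:
  assumes "ideal I L" "r \<in> R" "elt r \<in> I" "r w \<noteq> 0"
  shows "\<one>\<^bsub>L\<^esub> \<in> I"
  using assms(2-)
proof (induction w arbitrary: r)
  case Nil
  then obtain s where "s \<in> R" "r \<star> s = series_const 1" using right_inverse by blast
  then show ?case
    using Nil ideal.I_r_closed[OF assms(1), of "elt r" "elt s"] by (simp add: elt_mult[symmetric] elt_one)
next
  case (Cons x w)
  show ?case
  \<comment> \<open>The derivative is available only for a vanishing constant term; otherwise
    \<open>r\<close> is already invertible and the descent stops early.\<close>
  proof (cases "r [] = 0")
    case True
    then show ?thesis
      using Cons ideal.I_l_closed[OF assms(1), of "elt r" "star x"]
      by (intro Cons.IH[of "series_deriv x r"]) (simp_all add: star_mult_elt deriv, simp add: series_deriv_def)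
  next
    case False
    then obtain s where "s \<in> R" "r \<star> s = series_const 1" using Cons right_inverse by blast
    then show ?thesis
      using Cons ideal.I_r_closed[OF assms(1), of "elt r" "elt s"]
      by (simp add: elt_mult[symmetric] elt_one)
  qed
qed

section \<open>The localization is not zero\<close>

lemma relations_annihilate: "leavitt_relations R \<subseteq> annihilator R"
proof -
  let ?V = "series_var :: ('a, 'k) series + 'a \<Rightarrow> _"
  have minus: "leavitt_act (p \<ominus>\<^bsub>F\<^esub> q) f = (\<lambda>z. leavitt_act p f z - leavitt_act q f z)"
    if "p \<in> carrier F" "q \<in> carrier F" for p q f
    using that poly_eval_diff[of p "Inl ` R \<union> range Inr" q]
    by (simp add: leavitt_act_def leavitt_free_def)
  have I: "p \<ominus>\<^bsub>F\<^esub> q \<in> annihilator R"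
    if "p \<in> carrier F" "q \<in> carrier F"
      "\<And>f. f \<in> stream_module \<Longrightarrow> leavitt_act p f = leavitt_act q f" for p q
    using that minus[OF that(1,2)] F.minus_closed[OF that(1,2)] by (auto simp: annihilator_def)
  have [simp]: "gen_act (Inl r) f = series_act r f" for r :: "('a, 'k) series" and f
    by (simp add: gen_act_def)
  have lact: "leavitt_act (?V g \<star> ?V g') f = gen_act g (gen_act g' f)"
    if "f \<in> stream_module" for g g' f
    using that by (simp add: leavitt_act_var_mult leavitt_act_var)
  have "?V (Inl (a \<oplus>\<^bsub>series_ring\<^esub> b)) \<ominus>\<^bsub>F\<^esub> (?V (Inl a) \<oplus>\<^bsub>F\<^esub> ?V (Inl b)) \<in> annihilator R"
    if "a \<in> R" "b \<in> R" for a b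
  proof (rule I)
    fix f :: "'a stream \<times> int \<Rightarrow> 'k" assume "f \<in> stream_module"
    then show "leavitt_act (?V (Inl (a \<oplus>\<^bsub>series_ring\<^esub> b))) f
        = leavitt_act (?V (Inl a) \<oplus>\<^bsub>F\<^esub> ?V (Inl b)) f"
      using poly_eval_add[of "?V (Inl a)" "Inl ` R \<union> range Inr" "?V (Inl b)" "\<lambda>v. foldr gen_act v f"] that
      by (simp add: F_ops leavitt_act_def series_act_add)
  qed (use that add in auto)
  moreover have "?V (Inl (a \<star> b)) \<ominus>\<^bsub>F\<^esub> (?V (Inl a) \<otimes>\<^bsub>F\<^esub> ?V (Inl b)) \<in> annihilator R"
    if "a \<in> R" "b \<in> R" for a b
    by (rule I) (use that mult in \<open>auto simp: F_ops(2)[symmetric]\<close>,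
      simp add: F_ops lact leavitt_act_var series_act_mult)
  moreover have "?V (Inl (series_const c)) \<ominus>\<^bsub>F\<^esub> series_const c \<in> annihilator R" for c
    by (rule I) (use const in \<open>auto simp: leavitt_act_var leavitt_act_const series_act_const\<close>)
  moreover have "?V (Inr x) \<otimes>\<^bsub>F\<^esub> ?V (Inl (series_var y))
      \<ominus>\<^bsub>F\<^esub> (if x = y then \<one>\<^bsub>F\<^esub> else \<zero>\<^bsub>F\<^esub>) \<in> annihilator R" for x y
  proof (rule I)
    fix f :: "'a stream \<times> int \<Rightarrow> 'k" assume "f \<in> stream_module"
    then show "leavitt_act (?V (Inr x) \<otimes>\<^bsub>F\<^esub> ?V (Inl (series_var y))) f
        = leavitt_act (if x = y then \<one>\<^bsub>F\<^esub> else \<zero>\<^bsub>F\<^esub>) f"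
      using leavitt_act_const[of 0 f]
      by (auto simp: F_ops lact leavitt_act_const gen_act_def series_act_var)
  qed (use var in auto)
  moreover have "(\<Oplus>\<^bsub>F\<^esub>x\<in>UNIV. ?V (Inl (series_var x)) \<otimes>\<^bsub>F\<^esub> ?V (Inr x)) \<ominus>\<^bsub>F\<^esub> \<one>\<^bsub>F\<^esub> \<in> annihilator R"
  proof (rule I)
    fix f :: "'a stream \<times> int \<Rightarrow> 'k" assume f: "f \<in> stream_module"
    have t: "?V (Inl (series_var x)) \<star> ?V (Inr x) \<in> carrier F" for x
      using F.m_closed[of "?V (Inl (series_var x))" "?V (Inr x)"] var by (simp add: F_ops)
    have "leavitt_act (\<Oplus>\<^bsub>F\<^esub>x\<in>UNIV. ?V (Inl (series_var x)) \<otimes>\<^bsub>F\<^esub> ?V (Inr x)) f z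
        = (\<Sum>x\<in>UNIV. leavitt_act (?V (Inl (series_var x)) \<star> ?V (Inr x)) f z)" for z
      using t unfolding leavitt_act_def F_ops unfolding leavitt_free_def
      by (simp add: finsum_free_algebra) (rule poly_eval_sum[of _ _ "Inl ` R \<union> range Inr"], simp)
    also have "\<dots> z = f z" for z
    proof (cases z)
      case (Pair s d)
      \<comment> \<open>At a stream \<open>s\<close> only the summand of its head survives: it
        removes the head and puts it back.\<close>
      have "leavitt_act (?V (Inl (series_var x)) \<star> ?V (Inr x)) f z = (if shd s = x then f z else 0)" for x
        using f series_act_var[OF gen_act_closed[OF f, of "Inr x"], of x]
        by (auto simp: Pair lact) (simp add: gen_act_def)
      then show ?thesis by simp
    qed
    finally show "leavitt_act (\<Oplus>\<^bsub>F\<^esub>x\<in>UNIV. ?V (Inl (series_var x)) \<otimes>\<^bsub>F\<^esub> ?V (Inr x)) f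
        = leavitt_act \<one>\<^bsub>F\<^esub> f"
      by (simp add: F_ops leavitt_act_const fun_eq_iff)
  qed (use var in \<open>auto intro!: F.finsum_closed\<close>)
  ultimately show ?thesis
    unfolding leavitt_relations_def Let_def by blast
qed

text \<open>\<open>J\<close> annihilates the stream module, whereas 1 acts as the identity on
  it.\<close>

lemma one_neq_zero: "\<one>\<^bsub>L\<^esub> \<noteq> \<zero>\<^bsub>L\<^esub>"
proof
  assume "\<one>\<^bsub>L\<^esub> = \<zero>\<^bsub>L\<^esub>"
  then have "\<one>\<^bsub>F\<^esub> \<ominus>\<^bsub>F\<^esub> \<zero>\<^bsub>F\<^esub> \<in> J"
    using F.quotient_eq_iff_same_a_r_cos[OF ideal_J, of "\<one>\<^bsub>F\<^esub>" "\<zero>\<^bsub>F\<^esub>"] by simp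
  then have "series_const 1 \<in> annihilator R"
    using F.genideal_minimal[OF ideal_annihilator relations_annihilate] F.zero_closed
    by (auto simp: F_ops F_minus)
  \<comment> \<open>A non-zero module element: the indicator of degree 0, evaluated below at an
    arbitrary stream.\<close>
  moreover define f where "f = (\<lambda>(s :: 'a stream, d :: int). if d = 0 then 1 else 0 :: 'k)"
  moreover have "f \<in> stream_module"
    by (auto simp: f_def stream_module_def bounded_below_def intro!: exI[of _ 0])
  ultimately have "f = (\<lambda>z. 0)"
    by (simp add: annihilator_def leavitt_act_const)
  then have "f (undefined, 0) = 0" by simp
  then show False by (simp add: f_def)
qed

theorem simple_localization: "simple_ring L"
  unfolding simple_ring_def
proof (intro conjI allI impI)
  show "ring L" by (rule h.S.ring_axioms)
  show "carrier L \<noteq> {\<zero>\<^bsub>L\<^esub>}" using one_neq_zero h.S.one_closed by blast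
  fix I assume I: "ideal I L"
  have "\<one>\<^bsub>L\<^esub> \<in> I" if p: "p \<in> I" "p \<noteq> \<zero>\<^bsub>L\<^esub>" for p
  proof -
    have pL: "p \<in> carrier L" using p(1) ideal.Icarr[OF I] by blast
    then obtain N where
      N: "\<And>w. N \<le> length w \<Longrightarrow> \<exists>r\<in>R. p \<otimes>\<^bsub>L\<^esub> elt (series_monom 1 w) = elt r"
      using eventually_elt by blast
    \<comment> \<open>The length is exactly the \<open>N\<close> from which products with words lie
      in the image of \<open>R\<close>, so one word serves both purposes.\<close>
    obtain w where w: "length w = N" "p \<otimes>\<^bsub>L\<^esub> elt (series_monom 1 w) \<noteq> \<zero>\<^bsub>L\<^esub>"
      using monoms_faithful[OF pL] p(2) by blast
    then obtain r where r: "r \<in> R" "p \<otimes>\<^bsub>L\<^esub> elt (series_monom 1 w) = elt r"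
      using N[of w] by auto
    then have "elt r \<in> I"
      using ideal.I_r_closed[OF I p(1), of "elt (series_monom 1 w)"] monom by simp
    moreover have "r \<noteq> (\<lambda>v. 0)" using w(2) r(2) elt_zero by auto
    then obtain v where "r v \<noteq> 0" by (auto simp: fun_eq_iff)
    ultimately show ?thesis using ideal_contains_one[OF I r(1)] by blast
  qed
  then show "I = {\<zero>\<^bsub>L\<^esub>} \<or> I = carrier L"
    using ideal.one_imp_carrier[OF I] additive_subgroup.zero_closed[OF ideal.axioms(1)[OF I]] by blast
qed

end


section \<open>The rational closure\<close>

lemma subalgebraI:
  assumes "subring V series_ring" "range series_const \<subseteq> V"
  shows "subalgebra (range series_const) V series_ring"
proof (intro subalgebra.intro subalgebra_axioms.intro)
  show "subgroup V (add_monoid series_ring)" using assms(1) by (simp add: subring_def)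
  show "k \<otimes>\<^bsub>series_ring\<^esub> v \<in> V" if "k \<in> range series_const" "v \<in> V" for k v
    using that assms subringE(6)[OF assms(1)] by blast
qed

lemma series_deriv_in_free_algebra:
  assumes "f \<in> carrier (free_algebra UNIV)"
  shows "series_deriv x f \<in> carrier (free_algebra UNIV)"
proof -
  have "finite ((#) x -` {w. f w \<noteq> 0})"
    using assms by (intro finite_vimageI) (auto simp: carrier_free_algebra)
  then show ?thesis by (simp add: carrier_free_algebra series_deriv_def vimage_def)
qed

lemma leavitt_base_rational: "leavitt_base (rational_series :: ('a::finite, 'k::field) series set)"
proof -
  let ?R = "rational_series :: ('a, 'k) series set"
  define C :: "('a, 'k) series set \<Rightarrow> bool" where "C = (\<lambda>V. subring V series_ring \<and>
    subalgebra (range series_const) V series_ring \<and> carrier (free_algebra UNIV) \<subseteq> V \<and>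
    (\<forall>r\<in>V. r [] = 0 \<longrightarrow> quasi_inverse r \<in> V))"
  have R: "?R = \<Inter> {V. C V}" by (simp add: rational_series_def C_def)
  have poly: "f \<in> ?R" if "f \<in> carrier (free_algebra UNIV)" for f
    using that unfolding R C_def by blast
  have neg: "(\<lambda>w. - a w) \<in> ?R" if "a \<in> ?R" for a
    using that subringE(5)[of _ series_ring a] unfolding R C_def by simp
  have add: "(\<lambda>w. a w + b w) \<in> ?R" if "a \<in> ?R" "b \<in> ?R" for a b
    using that subringE(7)[of _ series_ring a b] unfolding R C_def by simp
  have mult: "a \<star> b \<in> ?R" if "a \<in> ?R" "b \<in> ?R" for a b
    using that subringE(6)[of _ series_ring a b] unfolding R C_def by simp
  have quasi_inverse: "quasi_inverse r \<in> ?R" if "r \<in> ?R" "r [] = 0" for r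
    using that unfolding R C_def by simp
  have scale: "(\<lambda>w. c * a w) \<in> ?R" if "a \<in> ?R" for a c
    using mult[OF poly[OF const_in_free_algebra[of c]] that] by simp
  \<comment> \<open>It suffices that \<open>?V\<close> satisfies the closure conditions
    \<open>C\<close>: as \<open>?R\<close> is the smallest such set, it is then contained in
    \<open>?V\<close>.\<close>
  let ?V = "{r \<in> ?R. \<forall>x. series_deriv x r \<in> ?R}"
  have poly_V: "carrier (free_algebra UNIV) \<subseteq> ?V"
    by (auto intro: poly series_deriv_in_free_algebra)
  have ring_V: "subring ?V series_ring"
  proof (rule series.subringI)
    show "\<one>\<^bsub>series_ring\<^esub> \<in> ?V" using poly by simp
    show "\<ominus>\<^bsub>series_ring\<^esub> a \<in> ?V" if "a \<in> ?V" for a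
      using that neg[of a] neg[of "series_deriv _ a"] by (simp add: series_deriv_def)
    show "a \<otimes>\<^bsub>series_ring\<^esub> b \<in> ?V" if "a \<in> ?V" "b \<in> ?V" for a b
      using that by (auto simp: series_deriv_mult mult intro!: add scale)
    show "a \<oplus>\<^bsub>series_ring\<^esub> b \<in> ?V" if "a \<in> ?V" "b \<in> ?V" for a b
      using that by (auto simp: series_deriv_add intro!: add)
  qed auto
  have "quasi_inverse r \<in> ?V" if r: "r \<in> ?V" "r [] = 0" for r
  proof -
    have q: "quasi_inverse r \<in> ?R" using r quasi_inverse by blast
    \<comment> \<open>Differentiate r^+ = r + r r^+; since \<open>r\<close> has no constant term,
      the derivative of r^+ does not reappear on the right.\<close>
    have "series_deriv x (quasi_inverse r)
        = (\<lambda>w. series_deriv x r w + (series_deriv x r \<star> quasi_inverse r) w)" for x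
      by (subst quasi_inverse_eq[of r, OF r(2)]) (simp add: series_deriv_add series_deriv_mult r(2))
    then show ?thesis using q r by (auto intro!: add mult)
  qed
  then have "C ?V"
    using ring_V poly_V subalgebraI[OF ring_V] const_in_free_algebra unfolding C_def by blast
  then have "?R \<subseteq> ?V" unfolding R by blast
  show ?thesis
  proof (rule leavitt_base.intro)
    show "subring ?R series_ring"
      by (rule series.subringI) (auto intro: poly neg add mult)
    show "series_deriv x r \<in> ?R" if "r \<in> ?R" for x r
      using that \<open>?R \<subseteq> ?V\<close> by blast
  qed (auto intro: poly quasi_inverse)
qed

section \<open>The algebraic closure\<close>

text \<open>
  The values of the polynomials in the variables and in elements of \<open>U\<close> that are allowed on the
  right-hand side of a proper system. A proper system then amounts to a finite set \<open>U\<close> of series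
  without constant term that satisfies \<open>U \<subseteq> proper_span U\<close>, and systems can be combined by
  taking unions.
\<close>

inductive_set proper_span :: "('a, 'k::field) series set \<Rightarrow> ('a, 'k) series set"
  for U where
  var: "series_var x \<in> proper_span U"
| add: "p \<in> proper_span U \<Longrightarrow> q \<in> proper_span U \<Longrightarrow> (\<lambda>w. p w + q w) \<in> proper_span U"
| scale: "p \<in> proper_span U \<Longrightarrow> (\<lambda>w. c * p w) \<in> proper_span U"
| mult: "p \<in> U \<or> p \<in> proper_span U \<Longrightarrow> q \<in> U \<or> q \<in> proper_span U \<Longrightarrow> p \<star> q \<in> proper_span U"

definition algebraic_system :: "('a, 'k::field) series set \<Rightarrow> bool" where
  "algebraic_system U \<longleftrightarrow> finite U \<and> (\<forall>u\<in>U. u [] = 0) \<and> U \<subseteq> proper_span U"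

text \<open>Components of a solution have no constant term, while an algebraic series may have one;
  only this part takes part in systems.\<close>

definition proper_part :: "('a, 'k::field) series \<Rightarrow> ('a, 'k) series" where
  "proper_part r = (\<lambda>w. if w = [] then 0 else r w)"

section \<open>Calculus of proper spans and proper parts\<close>

lemma proper_span_mono:
  assumes "p \<in> proper_span U" "U \<subseteq> V"
  shows "p \<in> proper_span V"
  using assms(1) by induction (use assms(2) in \<open>auto intro: proper_span.intros\<close>)

lemma proper_span_Nil:
  assumes "p \<in> proper_span U" "\<And>u. u \<in> U \<Longrightarrow> u [] = 0"
  shows "p [] = 0"
  using assms(1) by induction (use assms(2) in auto)

lemma proper_span_zero: "(\<lambda>w. 0) \<in> proper_span U"
  using proper_span.scale[OF proper_span.var, of 0] by simp

lemma proper_span_sum: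
  assumes "\<And>v. v \<in> A \<Longrightarrow> p v \<in> proper_span U"
  shows "(\<lambda>w. \<Sum>v\<in>A. p v w) \<in> proper_span U"
  using assms
  by (induction A rule: infinite_finite_induct) (auto simp: proper_span_zero intro: proper_span.add)

lemma proper_part_decomp: "r = (\<lambda>w. series_const (r []) w + proper_part r w)"
  by (auto simp: proper_part_def series_const_def)

lemma proper_part_id: "r [] = 0 \<Longrightarrow> proper_part r = r"
  by (auto simp: proper_part_def)

lemma proper_part_Nil [simp]: "proper_part r [] = 0"
  by (simp add: proper_part_def)

lemma proper_part_add: "proper_part (\<lambda>w. r w + s w) = (\<lambda>w. proper_part r w + proper_part s w)"
  by (auto simp: proper_part_def)

lemma proper_part_scale: "proper_part (\<lambda>w. c * r w) = (\<lambda>w. c * proper_part r w)"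
  by (auto simp: proper_part_def)

lemma proper_part_const [simp]: "proper_part (series_const c) = (\<lambda>w. 0)"
  by (auto simp: proper_part_def series_const_def)

text \<open>Split both factors into constant and proper part, expand, and drop the product of the
  constants.\<close>

lemma proper_part_mult:
  "proper_part (r \<star> s) = (\<lambda>w. (r [] * proper_part s w + s [] * proper_part r w)
     + (proper_part r \<star> proper_part s) w)"
proof -
  have "r \<star> s = (\<lambda>w. series_const (r [] * s []) w + ((r [] * proper_part s w + s [] * proper_part r w)
     + (proper_part r \<star> proper_part s) w))"
    by (subst proper_part_decomp[of r], subst proper_part_decomp[of s])
      (simp add: mult_add_left mult_add_right, auto simp: series_const_def algebra_simps)
  then show ?thesis
    by (metis (no_types, lifting) proper_part_def series_const_def add_0 mult_Nil proper_part_Nil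
        mult_zero_right add.right_neutral)
qed

lemma algebraic_system_Un:
  "algebraic_system U \<Longrightarrow> algebraic_system V \<Longrightarrow> algebraic_system (U \<union> V)"
  by (auto simp: algebraic_system_def intro: proper_span_mono)

text \<open>The new unknown \<open>p\<close> may occur in its own equation; this recursion is what
  admits quasi-inverses.\<close>

lemma algebraic_system_insert:
  assumes "algebraic_system U" "p \<in> proper_span (insert p U)" "p [] = 0"
  shows "algebraic_system (insert p U)"
  using assms by (auto simp: algebraic_system_def intro: proper_span_mono)

text \<open>A word of at least two letters is a product, where unknowns are allowed as factors, and
  a single variable is in the span by definition. The one-letter words \<open>[Inl j]\<close> are
  the linear terms that a proper system forbids.\<close>

lemma word_value_in_proper_span:
  assumes U: "U = u ` {..<m}" and v: "set v \<subseteq> Inl ` {..<m} \<union> range Inr" "v \<noteq> []"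
  shows "word_value u v \<in> U \<union> proper_span U"
    and "v \<notin> (\<lambda>j. [Inl j]) ` {..<m} \<Longrightarrow> word_value u v \<in> proper_span U"
proof -
  have letter: "case_sum u series_var s \<in> U \<union> proper_span U" if "s \<in> Inl ` {..<m} \<union> range Inr" for s
    using that by (auto simp: U intro: proper_span.var)
  have single: "word_value u [s] = case_sum u series_var s" for s
    by (simp add: word_value_Cons word_value_Nil)
  have all: "word_value u v \<in> U \<union> proper_span U"
    if "set v \<subseteq> Inl ` {..<m} \<union> range Inr" "v \<noteq> []" for v
    using that
  proof (induction v)
    case (Cons s v)
    show ?case
    proof (cases "v = []")
      case True
      then show ?thesis using letter[of s] Cons.prems by (simp add: single)
    next
      case False
      then show ?thesis
        using Cons letter[of s] proper_span.mult[of "case_sum u series_var s" U "word_value u v"]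
        by (simp add: word_value_Cons)
    qed
  qed simp
  then show "word_value u v \<in> U \<union> proper_span U" using v by blast
  assume n: "v \<notin> (\<lambda>j. [Inl j]) ` {..<m}"
  obtain s t where st: "v = s # t" using v(2) by (cases v) auto
  show "word_value u v \<in> proper_span U"
  proof (cases "t = []")
    case True
    then have "s \<in> range Inr" using n v(1) st by auto
    then show ?thesis using True st by (auto simp: single intro: proper_span.var)
  next
    case False
    then show ?thesis
      using letter[of s] all[of t] v(1) proper_span.mult[of "case_sum u series_var s" U "word_value u t"]
      by (simp add: st word_value_Cons)
  qed
qed

lemma poly_value_in_proper_span:
  assumes "q \<in> carrier (free_algebra (Inl ` {..<m} \<union> range Inr))" "q [] = 0"
    "\<And>j. j < m \<Longrightarrow> q [Inl j] = 0"
  shows "poly_value u q \<in> proper_span (u ` {..<m})"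
  unfolding poly_value_def
proof (intro proper_span_sum proper_span.scale word_value_in_proper_span(2)[OF refl])
  fix v assume v: "v \<in> {v. q v \<noteq> 0}"
  show "set v \<subseteq> Inl ` {..<m} \<union> range Inr" using v assms(1) by (simp add: carrier_free_algebra)
  show "v \<noteq> []" using v assms(2) by auto
  show "v \<notin> (\<lambda>j. [Inl j]) ` {..<m}" using v assms(3) by auto
qed

lemma proper_span_poly_value:
  assumes "p \<in> proper_span (u ` {..<m})"
  shows "\<exists>q\<in>carrier (free_algebra (Inl ` {..<m} \<union> range Inr)).
    q [] = 0 \<and> (\<forall>j<m. q [Inl j] = 0) \<and> poly_value u q = p"
  using assms
proof induction
  case (var x)
  show ?case
    by (rule bexI[of _ "series_var (Inr x)"]) (auto simp: poly_value_var, simp add: series_var_def)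
next
  case (add p p')
  then obtain q q' where q: "q \<in> carrier (free_algebra (Inl ` {..<m} \<union> range Inr))"
      "q [] = 0" "\<forall>j<m. q [Inl j] = 0" "poly_value u q = p"
    and q': "q' \<in> carrier (free_algebra (Inl ` {..<m} \<union> range Inr))"
      "q' [] = 0" "\<forall>j<m. q' [Inl j] = 0" "poly_value u q' = p'" by blast
  then show ?case
    using poly_eval_add[OF q(1) q'(1), of "word_value u"]
    by (intro bexI[of _ "\<lambda>w. q w + q' w"]) (auto simp: poly_value_eq_eval add_in_free_algebra)
next
  case (scale p c)
  then obtain q where q: "q \<in> carrier (free_algebra (Inl ` {..<m} \<union> range Inr))"
      "q [] = 0" "\<forall>j<m. q [Inl j] = 0" "poly_value u q = p" by blast
  then show ?case
    using mult_in_free_algebra[OF const_in_free_algebra[of c] q(1)]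
    by (intro bexI[of _ "\<lambda>w. c * q w"]) (auto simp: poly_value_eq_eval poly_eval_scale)
next
  case (mult p p')
  \<comment> \<open>A factor from \<open>U\<close> is a bare unknown, so the condition on linear
    terms is dropped for factors. The product regains it, because neither factor has a constant
    term.\<close>
  have *: "\<exists>q\<in>carrier (free_algebra (Inl ` {..<m} \<union> range Inr)). q [] = 0 \<and> poly_value u q = p"
    if "p \<in> u ` {..<m} \<or> (p \<in> proper_span (u ` {..<m}) \<and>
      (\<exists>q\<in>carrier (free_algebra (Inl ` {..<m} \<union> range Inr)).
        q [] = 0 \<and> (\<forall>j<m. q [Inl j] = 0) \<and> poly_value u q = p))" for p
    using that
  proof
    assume "p \<in> u ` {..<m}"
    then obtain j where "j < m" "p = u j" by auto
    then show ?thesis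
      by (intro bexI[of _ "series_var (Inl j)"]) (auto simp: poly_value_var)
  qed blast
  obtain q q' where q: "q \<in> carrier (free_algebra (Inl ` {..<m} \<union> range Inr))"
      "q [] = 0" "poly_value u q = p"
    and q': "q' \<in> carrier (free_algebra (Inl ` {..<m} \<union> range Inr))"
      "q' [] = 0" "poly_value u q' = p'" using *[OF mult(1)] *[OF mult(2)] by blast
  then show ?case
    using poly_value_mult[OF q(1) q'(1)]
    by (intro bexI[of _ "q \<star> q'"]) (auto simp: mult_in_free_algebra)
qed

lemma algebraic_series_iff:
  "r \<in> algebraic_series \<longleftrightarrow> (\<exists>U. algebraic_system U \<and> proper_part r \<in> U)"
proof
  assume "r \<in> algebraic_series"
  then obtain c u m p where r: "r = (\<lambda>w. series_const c w + u 0 w)" and m: "0 < m"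
    and p: "proper_system m p" and u: "solves_system m p u"
    by (auto simp: algebraic_series_def)
  have "u i \<in> proper_span (u ` {..<m})" if "i < m" for i
    using that p u poly_value_in_proper_span[of "p i" m u]
    by (auto simp: proper_system_def solves_system_def)
  then have "algebraic_system (u ` {..<m})"
    using u by (auto simp: algebraic_system_def solves_system_def)
  moreover have "proper_part r = u 0"
  proof -
    have "u 0 [] = 0" using u m unfolding solves_system_def by blast
    then show ?thesis by (simp add: r proper_part_add proper_part_id)
  qed
  ultimately show "\<exists>U. algebraic_system U \<and> proper_part r \<in> U"
    using m by (intro exI[of _ "u ` {..<m}"]) auto
next
  assume "\<exists>U. algebraic_system U \<and> proper_part r \<in> U"
  then obtain U where U: "algebraic_system U" "proper_part r \<in> U" by blast
  then obtain xs where xs: "set xs = U" using finite_list unfolding algebraic_system_def by blast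
  \<comment> \<open>The first component must be the proper part of \<open>r\<close>, so it is put in
    front although \<open>xs\<close> lists it already; the repetition leaves the set of values equal
    to \<open>U\<close>.\<close>
  define us where "us = proper_part r # xs"
  define m where "m = length us"
  define u where "u = (\<lambda>i. us ! i)"
  have "set us = U" using xs U(2) by (auto simp: us_def)
  then have u: "u ` {..<m} = U" unfolding u_def m_def by (auto simp: set_conv_nth)
  have "\<forall>i\<in>{..<m}. \<exists>q. q \<in> carrier (free_algebra (Inl ` {..<m} \<union> range Inr)) \<and>
    q [] = 0 \<and> (\<forall>j<m. q [Inl j] = 0) \<and> poly_value u q = u i"
  proof
    fix i assume "i \<in> {..<m}"
    then have "u i \<in> proper_span (u ` {..<m})"
      using U(1) u unfolding algebraic_system_def by blast
    from proper_span_poly_value[OF this] show "\<exists>q. q \<in> carrier (free_algebra (Inl ` {..<m} \<union> range Inr)) \<and>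
      q [] = 0 \<and> (\<forall>j<m. q [Inl j] = 0) \<and> poly_value u q = u i" by blast
  qed
  then obtain p where p: "\<And>i. i < m \<Longrightarrow> p i \<in> carrier (free_algebra (Inl ` {..<m} \<union> range Inr)) \<and>
    p i [] = 0 \<and> (\<forall>j<m. p i [Inl j] = 0) \<and> poly_value u (p i) = u i"
    unfolding bchoice_iff by (auto simp: lessThan_iff)
  have "proper_system m p" using p by (simp add: proper_system_def)
  moreover have "u i [] = 0" if "i < m" for i
    using that U(1) u by (auto simp: algebraic_system_def)
  then have "solves_system m p u" using p by (simp add: solves_system_def)
  moreover have "0 < m" by (simp add: m_def us_def)
  moreover have "r = series_const (r []) \<oplus>\<^bsub>series_ring\<^esub> u 0"
    using proper_part_decomp[of r] by (simp add: u_def us_def)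
  ultimately show "r \<in> algebraic_series" unfolding algebraic_series_def by blast
qed

lemma algebraic_seriesI:
  assumes "algebraic_system U" "proper_part r \<in> proper_span (insert (proper_part r) U)"
  shows "r \<in> algebraic_series"
  using algebraic_system_insert[OF assms] by (auto simp: algebraic_series_iff)

text \<open>
  The derivative of a product \<open>p q\<close> without constant terms is the product of the derivative of
  \<open>p\<close> with \<open>q\<close>, so adding the derivatives without their constant terms to a system gives a
  system again: a constant term multiplies \<open>q\<close>, which is in the span of \<open>U\<close> by assumption.
\<close>

lemma algebraic_system_deriv:
  assumes U: "algebraic_system U"
  shows "algebraic_system (U \<union> (\<lambda>u. proper_part (series_deriv x u)) ` U)"
proof -
  let ?D = "\<lambda>u. proper_part (series_deriv x u)"
  let ?U = "U \<union> ?D ` U"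
  have mono: "p \<in> proper_span ?U" if "p \<in> proper_span U" for p
    using that by (rule proper_span_mono) simp
  have "?D p \<in> proper_span ?U" if "p \<in> proper_span U" for p
    using that
  proof induction
    case (var y)
    then show ?case by (simp add: proper_span_zero)
  next
    case (add p q)
    then show ?case by (simp add: series_deriv_add proper_part_add proper_span.add)
  next
    case (scale p c)
    have "series_deriv x (\<lambda>w. c * p w) = (\<lambda>w. c * series_deriv x p w)"
      by (simp add: series_deriv_def)
    then show ?case using scale by (simp add: proper_part_scale proper_span.scale)
  next
    case (mult p q)
    have q: "q \<in> proper_span ?U"
      using mult U mono by (auto simp: algebraic_system_def)
    have 0: "p [] = 0" "q [] = 0"
      using mult U proper_span_Nil[of p U] proper_span_Nil[of q U] by (auto simp: algebraic_system_def)
    have "?D (p \<star> q) = (\<lambda>w. series_deriv x p [] * q w + (?D p \<star> q) w)"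
      using 0 proper_part_mult[of "series_deriv x p" q]
      by (simp add: series_deriv_mult proper_part_id)
    moreover have "?D p \<in> ?U \<or> ?D p \<in> proper_span ?U" using mult by blast
    ultimately show ?case using q by (simp add: proper_span.add proper_span.scale proper_span.mult)
  qed
  then show ?thesis using U mono by (auto simp: algebraic_system_def)
qed

lemma leavitt_base_algebraic: "leavitt_base (algebraic_series :: ('a::finite, 'k::field) series set)"
proof (rule leavitt_base.intro)
  let ?R = "algebraic_series :: ('a, 'k) series set"
  have empty: "algebraic_system {}" by (simp add: algebraic_system_def)
  show const: "series_const c \<in> ?R" for c
    by (rule algebraic_seriesI[OF empty]) (simp add: proper_span_zero)
  show "series_var x \<in> ?R" for x
    by (rule algebraic_seriesI[OF empty]) (simp add: proper_part_id proper_span.var)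
  show "subring ?R series_ring"
  proof (rule series.subringI)
    \<comment> \<open>Once both series live in the union of their systems, sums and products are
      computations in one proper span.\<close>
    have *: "\<exists>U. algebraic_system U \<and> proper_part r \<in> proper_span U \<and> proper_part s \<in> proper_span U"
      if rs: "r \<in> ?R" "s \<in> ?R" for r s
    proof -
      obtain U V where "algebraic_system U" "proper_part r \<in> U" "algebraic_system V" "proper_part s \<in> V"
        using rs unfolding algebraic_series_iff by blast
      then show ?thesis
        using algebraic_system_Un[of U V] unfolding algebraic_system_def
        by (intro exI[of _ "U \<union> V"]) blast
    qed
    have I: "t \<in> ?R" if "algebraic_system U" "proper_part t \<in> proper_span U" for t U
      by (rule algebraic_seriesI[OF that(1)]) (rule proper_span_mono[OF that(2)], blast)
    show "r \<oplus>\<^bsub>series_ring\<^esub> s \<in> ?R" if "r \<in> ?R" "s \<in> ?R" for r s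
      using *[OF that] by (auto simp: proper_part_add intro!: I proper_span.add)
    show m: "r \<otimes>\<^bsub>series_ring\<^esub> s \<in> ?R" if "r \<in> ?R" "s \<in> ?R" for r s
      using *[OF that]
      by (auto simp: proper_part_mult intro!: I proper_span.add proper_span.scale proper_span.mult)
    show "\<ominus>\<^bsub>series_ring\<^esub> r \<in> ?R" if "r \<in> ?R" for r
      using m[OF const[of "- 1"] that] by simp
  qed (auto intro: const)
  fix r :: "('a, 'k) series" assume "r \<in> ?R"
  then obtain U where U: "algebraic_system U" "proper_part r \<in> U"
    by (auto simp: algebraic_series_iff)
  show "series_deriv x r \<in> ?R" for x
  proof -
    \<comment> \<open>The derivative does not see the constant term of \<open>r\<close>, so it may
      be taken of the member of \<open>U\<close>.\<close>
    have "proper_part (series_deriv x r) = proper_part (series_deriv x (proper_part r))"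
      by (simp add: series_deriv_def proper_part_def)
    then show ?thesis using algebraic_system_deriv[OF U(1), of x] U(2)
      unfolding algebraic_series_iff by blast
  qed
  assume "r [] = 0"
  then have r: "r \<in> U" "r \<in> proper_span U" and q: "quasi_inverse r = (\<lambda>w. r w + (r \<star> quasi_inverse r) w)"
    using U quasi_inverse_eq[of r] by (auto simp: proper_part_id algebraic_system_def)
  \<comment> \<open>The identity q = r + r q is itself a proper equation for a new unknown q: q
    occurs only as a factor, and the term \<open>r\<close> is already in the span of
    \<open>U\<close>.\<close>
  let ?U = "insert (quasi_inverse r) U"
  have "(\<lambda>w. r w + (r \<star> quasi_inverse r) w) \<in> proper_span ?U"
    using r proper_span_mono[OF r(2), of ?U] by (intro proper_span.add proper_span.mult) auto
  then show "quasi_inverse r \<in> ?R"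
    using q by (intro algebraic_seriesI[OF U(1)]) (simp add: proper_part_id)
qed

theorem corollary5p5:
  fixes R :: "('x::finite, 'k::field) series set"
  assumes "2 \<le> CARD('x)"
    and "R = rational_series \<or> R = algebraic_series"
  shows "simple_ring (leavitt_localization R)"
  using assms(2) leavitt_base.simple_localization leavitt_base_rational leavitt_base_algebraic
  by blast

end
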